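(* Let $1\le k\le n$ be integers. Let $Q$ be uniformly distributed on the Stiefel manifold $\mathbb{V}_k^n$, and let $G\in\mathbb{M}^{n\times k}$ be a normalized Gaussian matrix, i.e. with independent $\mathrm{N}(0,n^{-1})$ entries. Suppose that $\Vert\cdot\Vert_Y$ is a norm on $\mathbb{R}^k$ and $\Vert\cdot\Vert_Z$ is a norm on $\mathbb{R}^n$. Then $$\mathbb{E}\,\Vert G\Vert_{Y\to Z} \le \big(n^{-1/2}\,\mathbb{E}\,\Vert T\Vert_{Y\to Y}\big)\cdot\big(\mathbb{E}\,\Vert Q\Vert_{Y\to Z}\big),$$ where $T$ is either of the following two random $k\times k$ matrices (the inequality holds for each choice): the random upper-triangular matrix $R$, or the Wishart square root $W$, both defined in the context.
   Context: $\mathbb{M}^{n\times k}$ is the space of real $n\times k$ matrices. The Stiefel manifold is $\mathbb{V}_k^n := \{Q\in\mathbb{M}^{n\times k} : Q^*Q=\mathrm{I}\}$; "uniformly distributed" means distributed according to the Haar probability measure on $\mathbb{V}_k^n$, invariant under orthogonal transformations on the left and the right. For a matrix $A\in\mathbb{M}^{n\times k}$, $\Vert A\Vert_{Y\to Z} := \sup\{\Vert Ax\Vert_Z : \Vert x\Vert_Y\le 1\}$ is the operator norm from $(\mathbb{R}^k,\Vert\cdot\Vert_Y)$ to $(\mathbb{R}^n,\Vert\cdot\Vert_Z)$; $\Vert\cdot\Vert_{Y\to Y}$ on $\mathbb{M}^{k\times k}$ is defined likewise. $R$ is the random $k\times k$ upper-triangular matrix with diagonal entries $R_{ii} = X_i\ge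 0$ where $X_i^2\sim\chi^2_{n-i+1}$ (chi-square with $n-i+1$ degrees of freedom), super-diagonal entries $R_{ij}=Y_{ij}\sim\mathrm{N}(0,1)$ for $i<j$, zeros below the diagonal, and all the variables $X_i$, $Y_{ij}$ mutually independent. $W$ is the positive (semidefinite) square root of a $k\times k$ Wishart matrix with $n$ degrees of freedom, i.e. $W$ has the distribution of $(\Gamma^*\Gamma)^{1/2}$ where $\Gamma\in\mathbb{M}^{n\times k}$ has independent $\mathrm{N}(0,1)$ entries. *)

theory Defs
  imports "HOL-Probability.Probability"
begin

definition is_norm :: "('a::real_vector \<Rightarrow> real) \<Rightarrow> bool" where
  "is_norm p \<longleftrightarrow>
     (\<forall>x. 0 \<le> p x) \<and> (\<forall>x. p x = 0 \<longleftrightarrow> x = 0) \<and>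
     (\<forall>c x. p (c *\<^sub>R x) = \<bar>c\<bar> * p x) \<and> (\<forall>x y. p (x + y) \<le> p x + p y)"

definition op_norm :: "(real^'k \<Rightarrow> real) \<Rightarrow> (real^'n \<Rightarrow> real) \<Rightarrow> real^'k^'n \<Rightarrow> real" where
  "op_norm Y Z A = Sup {Z (A *v x) | x. Y x \<le> 1}"

text \<open>The \<open>n \<times> k\<close> matrices form the type \<^typ>\<open>real^'k^'n\<close>: the outer index is the row.\<close>

definition stiefel :: "(real^'k^'n) set" where
  "stiefel = {Q. transpose Q ** Q = mat 1}"

text \<open>The Haar measure is represented as a Borel measure on the whole matrix space that is
  carried by the Stiefel manifold.\<close>

definition haar_stiefel :: "(real^'k^'n) measure \<Rightarrow> bool" where
  "haar_stiefel \<mu> \<longleftrightarrow>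
     prob_space \<mu> \<and> sets \<mu> = sets borel \<and> (AE Q in \<mu>. Q \<in> stiefel) \<and>
     (\<forall>(U :: real^'n^'n) (V :: real^'k^'k). orthogonal_matrix U \<longrightarrow> orthogonal_matrix V \<longrightarrow>
        distr \<mu> borel (\<lambda>Q. U ** Q ** V) = \<mu>)"

definition uniform_stiefel :: "'w measure \<Rightarrow> ('w \<Rightarrow> real^'k^'n) \<Rightarrow> bool" where
  "uniform_stiefel M Q \<longleftrightarrow> Q \<in> borel_measurable M \<and> haar_stiefel (distr M borel Q)"

text \<open>The parameter \<open>v\<close> is the variance of the entries; \<^const>\<open>normal_density\<close> takes the
  standard deviation.\<close>

definition gaussian_matrix :: "'w measure \<Rightarrow> real \<Rightarrow> ('w \<Rightarrow> real^'k^'n) \<Rightarrow> bool" where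
  "gaussian_matrix M v G \<longleftrightarrow>
     prob_space.indep_vars M (\<lambda>_. borel) (\<lambda>(i, j) \<omega>. G \<omega> $ i $ j) UNIV \<and>
     (\<forall>i j. distributed M lborel (\<lambda>\<omega>. G \<omega> $ i $ j) (normal_density 0 (sqrt v)))"

text \<open>The chi-square law with \<open>d\<close> degrees of freedom: the law of the sum of the squares of \<open>d\<close>
  independent standard normal variables.\<close>

definition chi_square :: "nat \<Rightarrow> real measure" where
  "chi_square d =
     distr (\<Pi>\<^sub>M i\<in>{..<d}. std_normal_distribution) borel (\<lambda>x. \<Sum>i<d. (x i)\<^sup>2)"

text \<open>Rows and columns are ordered by a linear order on the finite index type. The index \<open>i\<close> is
  the \<open>card {..i}\<close>-th one, counted from 1.\<close>

definition chi_normal_triangular ::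
    "'w measure \<Rightarrow> nat \<Rightarrow> ('w \<Rightarrow> real^('k::{finite,linorder})^('k::{finite,linorder})) \<Rightarrow> bool" where
  "chi_normal_triangular M n R \<longleftrightarrow>
     R \<in> borel_measurable M \<and>
     prob_space.indep_vars M (\<lambda>_. borel) (\<lambda>(i, j) \<omega>. R \<omega> $ i $ j) {(i, j). i \<le> j} \<and>
     (\<forall>i. AE \<omega> in M. 0 \<le> R \<omega> $ i $ i) \<and>
     (\<forall>i. distr M borel (\<lambda>\<omega>. (R \<omega> $ i $ i)\<^sup>2) = chi_square (n - card {..i} + 1)) \<and>
     (\<forall>i j. i < j \<longrightarrow> distributed M lborel (\<lambda>\<omega>. R \<omega> $ i $ j) std_normal_density) \<and>
     (\<forall>i j. j < i \<longrightarrow> (AE \<omega> in M. R \<omega> $ i $ j = 0))"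

definition pos_semidef :: "real^'k^'k \<Rightarrow> bool" where
  "pos_semidef A \<longleftrightarrow> transpose A = A \<and> (\<forall>x. 0 \<le> x \<bullet> (A *v x))"

definition psd_sqrt :: "real^'k^'k \<Rightarrow> real^'k^'k" where
  "psd_sqrt A = (THE B. pos_semidef B \<and> B ** B = A)"

text \<open>The number \<open>n\<close> of degrees of freedom is the cardinality of the type \<open>'n\<close>. The Gaussian
  matrix \<open>\<Gamma>\<close> need not live on the space of \<open>W\<close>; it is given through its law \<open>\<gamma>\<close>, as
  the identity on the space of \<open>n \<times> k\<close> matrices.\<close>

definition wishart_sqrt :: "'n::finite itself \<Rightarrow> 'w measure \<Rightarrow> ('w \<Rightarrow> real^'k^'k) \<Rightarrow> bool" where
  "wishart_sqrt _ M W \<longleftrightarrow>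
     W \<in> borel_measurable M \<and>
     (\<exists>\<gamma> :: (real^'k^'n) measure.
        prob_space \<gamma> \<and> sets \<gamma> = sets borel \<and> gaussian_matrix \<gamma> 1 (\<lambda>\<Gamma>. \<Gamma>) \<and>
        distr M borel W = distr \<gamma> borel (\<lambda>\<Gamma>. psd_sqrt (transpose \<Gamma> ** \<Gamma>)))"

end

theory Submission
  imports Defs
begin

text \<open>Let \<open>\<Gamma>\<close> be a standard Gaussian \<open>n \<times> k\<close> matrix. If \<open>T\<^sup>*T = A\<^sup>*A\<close> then \<open>A = QT\<close> for some \<open>Q\<close> in the
  Stiefel manifold, so \<open>\<parallel>A\<parallel> \<le> \<parallel>Q\<parallel> \<parallel>T\<parallel>\<close>. The law of \<open>\<Gamma>\<close> is invariant under left multiplication by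
  orthogonal matrices, hence \<open>\<parallel>\<cdot>\<parallel>\<close> may be replaced by finite averages of its translates, and suitable
  averages exceed \<open>E \<parallel>Q\<parallel>\<close> by at most \<open>\<epsilon>\<close> on the whole Stiefel manifold. This gives
  \<open>E \<parallel>\<Gamma>\<parallel> \<le> E \<parallel>Q\<parallel> \<cdot> E g(\<Gamma>)\<close>, where \<open>g(A)\<close> is the least norm of a \<open>T\<close> with \<open>T\<^sup>*T = A\<^sup>*A\<close>. For \<open>W\<close> one
  uses \<open>g(\<Gamma>) \<le> \<parallel>(\<Gamma>\<^sup>*\<Gamma>)\<^sup>1\<^sup>/\<^sup>2\<parallel>\<close>. For \<open>R\<close>, since \<open>g\<close> is invariant under the orthogonal group, \<open>\<Gamma>\<close> can be
  brought to triangular form column by column by reflections without changing \<open>E g(\<Gamma>)\<close>.\<close>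

subsection \<open>Operator norms\<close>

text \<open>The factorization A = QT is used pointwise only: its Q is neither chosen measurably nor
  tied to the given uniform matrix, so its norm cannot simply be replaced by a mean. It has to be
  bounded at every point of the manifold by a number close to that mean, which is why the norm is
  flattened. Flattening is harmless because translates act from the left and T from the right, so
  f(AT) <= f(A) times the norm of T survives averaging. Since R and W live on their own probability
  spaces, only their laws can be compared with that of \<open>\<Gamma>\<close>. The reflections that
  make \<open>\<Gamma>\<close> triangular depend on \<open>\<Gamma>\<close>, so the integrand must
  be unchanged by them, and the norms of a triangular factor and of the square root differ in
  general. The least norm depends on the Gram matrix alone and lies below both.\<close>

lemma is_normD:
  assumes "is_norm p"
  shows is_norm_nonneg: "0 \<le> p x" and is_norm_eq_0: "p x = 0 \<longleftrightarrow> x = 0"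
    and is_norm_scaleR: "p (c *\<^sub>R x) = \<bar>c\<bar> * p x" and is_norm_triangle: "p (x + y) \<le> p x + p y"
  using assms unfolding is_norm_def by blast+

lemma is_norm_sum:
  assumes "is_norm p"
  shows "p (sum f S) \<le> (\<Sum>i\<in>S. p (f i))"
proof (induction S rule: infinite_finite_induct)
  case (insert i S)
  then show ?case using is_norm_triangle[OF assms, of "f i" "sum f S"] by simp
qed (use is_norm_eq_0[OF assms, of 0] in simp_all)

text \<open>Expansion in the standard basis. Together with \<open>is_norm_lower\<close> this is the
  equivalence of norms in finite dimension, on which finiteness and continuity of operator norms
  rest.\<close>

lemma is_norm_upper:
  fixes p :: "'a::euclidean_space \<Rightarrow> real"
  assumes p: "is_norm p"
  obtains C where "C > 0" "\<And>x. p x \<le> C * norm x"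
proof
  let ?C = "(\<Sum>b\<in>Basis. p b) + 1"
  have nn: "0 \<le> (\<Sum>b\<in>Basis. p b)" by (simp add: sum_nonneg is_norm_nonneg[OF p])
  then show "?C > 0" by simp
  fix x
  have "p x = p (\<Sum>b\<in>Basis. (x \<bullet> b) *\<^sub>R b)" by (simp add: euclidean_representation)
  also have "\<dots> \<le> (\<Sum>b\<in>Basis. \<bar>x \<bullet> b\<bar> * p b)"
    using is_norm_sum[OF p, of "\<lambda>b. (x \<bullet> b) *\<^sub>R b" Basis] by (simp add: is_norm_scaleR[OF p])
  also have "\<dots> \<le> (\<Sum>b\<in>Basis. norm x * p b)"
    by (intro sum_mono mult_right_mono is_norm_nonneg[OF p] Basis_le_norm)
  also have "\<dots> \<le> ?C * norm x"
    by (simp add: sum_distrib_left[symmetric] algebra_simps)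
  finally show "p x \<le> ?C * norm x" .
qed

lemma is_norm_minus: "is_norm p \<Longrightarrow> p (- x) = p x"
  using is_norm_scaleR[of p "-1" x] by simp

lemma is_norm_diff:
  assumes p: "is_norm p"
  shows "\<bar>p x - p y\<bar> \<le> p (x - y)"
  using is_norm_triangle[OF p, of "x - y" y] is_norm_triangle[OF p, of "y - x" x]
    is_norm_minus[OF p, of "x - y"] by simp

lemma is_norm_continuous:
  fixes p :: "'a::euclidean_space \<Rightarrow> real"
  assumes p: "is_norm p"
  shows "continuous_on S p"
proof -
  obtain C where C: "C > 0" "\<And>x. p x \<le> C * norm x" using is_norm_upper[OF p] by blast
  have "C-lipschitz_on S p"
    by (rule lipschitz_onI)
      (use C is_norm_diff[OF p] in \<open>auto simp: dist_norm intro: order_trans\<close>)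
  then show ?thesis by (rule lipschitz_on_continuous_on)
qed

text \<open>The minimum of \<open>p\<close> on the compact unit sphere is positive; by homogeneity
  its inverse is the constant.\<close>

lemma is_norm_lower:
  fixes p :: "'a::euclidean_space \<Rightarrow> real"
  assumes p: "is_norm p"
  obtains c where "c > 0" "\<And>x. norm x \<le> c * p x"
proof -
  have "\<exists>z\<in>sphere (0::'a) 1. \<forall>y\<in>sphere 0 1. p z \<le> p y"
    by (intro continuous_attains_inf is_norm_continuous[OF p]) (auto simp: compact_sphere)
  then obtain z :: 'a where z: "norm z = 1" "\<And>y. norm y = 1 \<Longrightarrow> p z \<le> p y" by auto
  have pz: "p z > 0"
    using z(1) is_norm_nonneg[OF p, of z] is_norm_eq_0[OF p, of z] by (cases "z = 0") auto
  show ?thesis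
  proof
    show "1 / p z > 0" using pz by simp
    fix x :: 'a
    show "norm x \<le> 1 / p z * p x"
    proof (cases "x = 0")
      case False
      have "p z \<le> p ((1 / norm x) *\<^sub>R x)" using False by (intro z) simp
      then show ?thesis using False pz unfolding is_norm_scaleR[OF p] by (simp add: field_simps)
    qed (simp add: is_norm_nonneg[OF p] pz order_less_imp_le)
  qed
qed

text \<open>The norm on \<open>real^'k^'n\<close> is the Frobenius norm; Cauchy-Schwarz is applied
  to each row.\<close>

lemma norm_matrix_vector_mult_le:
  fixes A :: "real^'k^'n" and x :: "real^'k"
  shows "norm (A *v x) \<le> norm A * norm x"
proof -
  have "(norm (A *v x))\<^sup>2 = (\<Sum>i\<in>UNIV. (A $ i \<bullet> x)\<^sup>2)"
    by (simp add: norm_vec_def L2_set_def sum_nonneg matrix_vector_mult_def inner_vec_def)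
  also have "\<dots> \<le> (\<Sum>i\<in>UNIV. (norm (A $ i))\<^sup>2 * (norm x)\<^sup>2)"
    by (intro sum_mono)
      (metis Cauchy_Schwarz_ineq2 abs_ge_zero power2_abs power_mono power_mult_distrib)
  also have "\<dots> = (norm A * norm x)\<^sup>2"
    by (simp add: norm_vec_def[of A] L2_set_def sum_nonneg power_mult_distrib sum_distrib_right)
  finally show ?thesis by (rule power2_le_imp_le) simp
qed

context
  fixes Y :: "real^'k \<Rightarrow> real" and Z :: "real^'n \<Rightarrow> real"
  assumes Y: "is_norm Y" and Z: "is_norm Z"
begin

lemma op_norm_bound: "\<exists>C. 0 < C \<and> (\<forall>A x. Z (A *v x) \<le> C * norm A * Y x)"
proof -
  obtain C where C: "C > 0" "\<And>x. Z x \<le> C * norm x" using is_norm_upper[OF Z] by blast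
  obtain c where c: "c > 0" "\<And>x. norm x \<le> c * Y x" using is_norm_lower[OF Y] by blast
  have "Z (A *v x) \<le> (C * c) * norm A * Y x" for A x
  proof -
    have "Z (A *v x) \<le> C * (norm A * norm x)"
      using C(2)[of "A *v x"] norm_matrix_vector_mult_le[of A x] C(1)
      by (meson mult_left_mono order_less_imp_le order_trans)
    also have "\<dots> \<le> C * (norm A * (c * Y x))"
      using C(1) c(2)[of x] by (intro mult_left_mono) auto
    finally show ?thesis by (simp add: mult_ac)
  qed
  then show ?thesis using C(1) c(1) by (intro exI[of _ "C * c"]) auto
qed

text \<open>A real \<open>Sup\<close> carries information only for nonempty bounded sets, so the
  rules for \<open>op_norm\<close> rest on this.\<close>

lemma op_norm_bdd: "bdd_above {Z (A *v x) | x. Y x \<le> 1}"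
proof -
  obtain C where C: "0 < C" "\<And>A x. Z (A *v x) \<le> C * norm A * Y x" using op_norm_bound by blast
  show ?thesis
  proof (rule bdd_aboveI, clarify)
    fix x assume "Y x \<le> 1"
    then have "C * norm A * Y x \<le> C * norm A * 1" using C(1) by (intro mult_left_mono) auto
    with C(2)[of A x] show "Z (A *v x) \<le> C * norm A" by simp
  qed
qed

lemma op_norm_nonempty: "{Z (A *v x) | x. Y x \<le> 1} \<noteq> {}"
  using is_norm_eq_0[OF Y, of 0] by (auto intro!: exI[of _ 0])

lemma op_norm_upper: "Z (A *v x) \<le> op_norm Y Z A * Y x"
proof (cases "x = 0")
  case True
  then show ?thesis using is_norm_eq_0[OF Y, of 0] is_norm_eq_0[OF Z, of 0] by simp
next
  case False
  then have Yx: "Y x > 0" using is_norm_nonneg[OF Y, of x] is_norm_eq_0[OF Y, of x] by simp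
  have "Z (A *v ((1 / Y x) *\<^sub>R x)) \<le> op_norm Y Z A"
    unfolding op_norm_def
    by (rule cSup_upper[OF _ op_norm_bdd]) (use Yx in \<open>auto simp: is_norm_scaleR[OF Y]
      intro!: exI[of _ "(1 / Y x) *\<^sub>R x"]\<close>)
  then show ?thesis using Yx
    by (simp add: matrix_vector_mult_scaleR is_norm_scaleR[OF Z] field_simps)
qed

lemma op_norm_least:
  assumes "\<And>x. Y x \<le> 1 \<Longrightarrow> Z (A *v x) \<le> c"
  shows "op_norm Y Z A \<le> c"
  unfolding op_norm_def by (rule cSup_least[OF op_norm_nonempty]) (use assms in auto)

lemma op_norm_nonneg: "0 \<le> op_norm Y Z A"
  unfolding op_norm_def
  by (rule cSup_upper[OF _ op_norm_bdd])
    (use is_norm_eq_0[OF Y, of 0] is_norm_eq_0[OF Z, of 0] in \<open>auto intro!: exI[of _ 0]\<close>)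

lemma op_norm_le_norm: "\<exists>C>0. \<forall>A. op_norm Y Z A \<le> C * norm A"
proof -
  obtain C where C: "0 < C" "\<And>A x. Z (A *v x) \<le> C * norm A * Y x" using op_norm_bound by blast
  have "op_norm Y Z A \<le> C * norm A" for A
  proof (rule op_norm_least)
    fix x assume "Y x \<le> 1"
    then have "C * norm A * Y x \<le> C * norm A * 1" using C(1) by (intro mult_left_mono) auto
    with C(2)[of A x] show "Z (A *v x) \<le> C * norm A" by simp
  qed
  with C(1) show ?thesis by blast
qed

lemma op_norm_triangle: "op_norm Y Z (A + B) \<le> op_norm Y Z A + op_norm Y Z B"
proof (rule op_norm_least)
  fix x assume x: "Y x \<le> 1"
  have "Z ((A + B) *v x) \<le> Z (A *v x) + Z (B *v x)"
    by (simp add: matrix_vector_mult_add_rdistrib is_norm_triangle[OF Z])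
  also have "\<dots> \<le> op_norm Y Z A * Y x + op_norm Y Z B * Y x"
    by (intro add_mono op_norm_upper)
  also have "\<dots> \<le> op_norm Y Z A * 1 + op_norm Y Z B * 1"
    by (intro add_mono mult_left_mono x op_norm_nonneg)
  finally show "Z ((A + B) *v x) \<le> op_norm Y Z A + op_norm Y Z B" by simp
qed

lemma op_norm_scaleR: "op_norm Y Z (c *\<^sub>R A) = \<bar>c\<bar> * op_norm Y Z A"
proof -
  have le: "op_norm Y Z (c *\<^sub>R A) \<le> \<bar>c\<bar> * op_norm Y Z A" for c A
  proof (rule op_norm_least)
    fix x assume x: "Y x \<le> 1"
    have "Z ((c *\<^sub>R A) *v x) = \<bar>c\<bar> * Z (A *v x)"
      by (simp add: scaleR_matrix_vector_assoc[symmetric] is_norm_scaleR[OF Z])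
    also have "\<dots> \<le> \<bar>c\<bar> * (op_norm Y Z A * 1)"
      using op_norm_upper[of A x] mult_left_mono[OF x op_norm_nonneg[of A]]
      by (intro mult_left_mono) auto
    finally show "Z ((c *\<^sub>R A) *v x) \<le> \<bar>c\<bar> * op_norm Y Z A" by simp
  qed
  show ?thesis
  proof (cases "c = 0")
    case True
    then show ?thesis using le[of c A] op_norm_nonneg[of "c *\<^sub>R A"] by simp
  next
    case False
    have "\<bar>c\<bar> * op_norm Y Z A \<le> \<bar>c\<bar> * (\<bar>1 / c\<bar> * op_norm Y Z (c *\<^sub>R A))"
      using le[of "1 / c" "c *\<^sub>R A"] False by (intro mult_left_mono) auto
    then show ?thesis using le[of c A] False by (simp add: field_simps)
  qed
qed

text \<open>The Frobenius norm on the right is invariant under orthogonal left factors, so the same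
  constant will serve for all averages of translates.\<close>

lemma op_norm_lipschitz: "\<exists>L>0. \<forall>A B. \<bar>op_norm Y Z A - op_norm Y Z B\<bar> \<le> L * norm (A - B)"
proof -
  obtain C where C: "C > 0" "\<And>A. op_norm Y Z A \<le> C * norm A" using op_norm_le_norm by blast
  have "op_norm Y Z A - op_norm Y Z B \<le> C * norm (A - B)" for A B
    using op_norm_triangle[of "A - B" B] C(2)[of "A - B"] by simp
  from this[of A B for A B] this[of B A for A B] C(1) show ?thesis
    by (metis abs_le_iff minus_diff_eq norm_minus_commute)
qed

lemma op_norm_continuous: "continuous_on S (op_norm Y Z)"
proof -
  obtain L where "L > 0" "\<And>A B. \<bar>op_norm Y Z A - op_norm Y Z B\<bar> \<le> L * norm (A - B)"
    using op_norm_lipschitz by blast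
  then have "L-lipschitz_on S (op_norm Y Z)"
    by (intro lipschitz_onI) (auto simp: dist_norm)
  then show ?thesis by (rule lipschitz_on_continuous_on)
qed

end

lemma op_norm_mult:
  assumes Y: "is_norm Y" and Z: "is_norm Z"
  shows "op_norm Y Z (A ** B) \<le> op_norm Y Z A * op_norm Y Y B"
proof (rule op_norm_least[OF Y Z])
  fix x assume x: "Y x \<le> 1"
  have "Z (A ** B *v x) \<le> op_norm Y Z A * Y (B *v x)"
    by (simp add: matrix_vector_mul_assoc[symmetric] op_norm_upper[OF Y Z])
  also have "\<dots> \<le> op_norm Y Z A * (op_norm Y Y B * 1)"
    using op_norm_upper[OF Y Y, of B x] mult_left_mono[OF x op_norm_nonneg[OF Y Y, of B]]
    by (intro mult_left_mono op_norm_nonneg[OF Y Z]) auto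
  finally show "Z (A ** B *v x) \<le> op_norm Y Z A * op_norm Y Y B" by simp
qed

subsection \<open>Polar decomposition\<close>

text \<open>The inner product of matrices is the trace form, for which multiplication by
  \<open>transpose A\<close> is adjoint to multiplication by \<open>A\<close>.\<close>

lemma inner_matrix_mult_left:
  fixes A :: "real^'m^'n" and B :: "real^'k^'m" and C :: "real^'k^'n"
  shows "(A ** B) \<bullet> C = B \<bullet> (transpose A ** C)"
proof -
  have "(A ** B) \<bullet> C = (\<Sum>i\<in>UNIV. \<Sum>j\<in>UNIV. \<Sum>l\<in>UNIV. A$i$l * B$l$j * C$i$j)"
    by (simp add: inner_vec_def matrix_matrix_mult_def sum_distrib_right)
  also have "\<dots> = (\<Sum>i\<in>UNIV. \<Sum>l\<in>UNIV. \<Sum>j\<in>UNIV. A$i$l * B$l$j * C$i$j)"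
    by (intro sum.cong refl sum.swap)
  also have "\<dots> = (\<Sum>l\<in>UNIV. \<Sum>i\<in>UNIV. \<Sum>j\<in>UNIV. A$i$l * B$l$j * C$i$j)"
    by (rule sum.swap)
  also have "\<dots> = (\<Sum>l\<in>UNIV. \<Sum>j\<in>UNIV. \<Sum>i\<in>UNIV. A$i$l * B$l$j * C$i$j)"
    by (intro sum.cong refl sum.swap)
  also have "\<dots> = B \<bullet> (transpose A ** C)"
    by (simp add: inner_vec_def matrix_matrix_mult_def transpose_def sum_distrib_left mult_ac)
  finally show ?thesis .
qed

lemma inner_transpose:
  fixes A B :: "real^'k^'n"
  shows "transpose A \<bullet> transpose B = A \<bullet> B"
  by (simp add: inner_vec_def transpose_def) (rule sum.swap)

lemma inner_matrix_mult_right: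
  fixes A :: "real^'m^'n" and B :: "real^'k^'m" and C :: "real^'k^'n"
  shows "(A ** B) \<bullet> C = A \<bullet> (C ** transpose B)"
proof -
  have "(A ** B) \<bullet> C = (transpose B ** transpose A) \<bullet> transpose C"
    by (metis inner_transpose matrix_transpose_mul)
  also have "\<dots> = transpose A \<bullet> transpose (C ** transpose B)"
    by (simp add: inner_matrix_mult_left matrix_transpose_mul)
  finally show ?thesis by (simp only: inner_transpose)
qed

lemma norm_orthogonal_mult:
  fixes U :: "real^'n^'n" and A :: "real^'k^'n"
  assumes "orthogonal_matrix U"
  shows "norm (U ** A) = norm A"
  using assms
  by (simp add: norm_eq_sqrt_inner inner_matrix_mult_left matrix_mul_assoc orthogonal_matrix)

lemma orthogonal_mult_stiefel:
  assumes "orthogonal_matrix U" "Q \<in> stiefel"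
  shows "U ** Q \<in> stiefel"
  using assms
  by (simp add: stiefel_def orthogonal_matrix matrix_transpose_mul matrix_mul_assoc)
    (metis matrix_mul_assoc matrix_mul_rid)

lemma stiefel_mult_orthogonal:
  assumes "Q \<in> stiefel" "orthogonal_matrix V"
  shows "Q ** V \<in> stiefel"
proof -
  have "transpose (Q ** V) ** (Q ** V) = transpose V ** (transpose Q ** Q) ** V"
    by (simp add: matrix_transpose_mul matrix_mul_assoc)
  then show ?thesis using assms by (simp add: stiefel_def orthogonal_matrix)
qed

lemma norm_stiefel:
  assumes "(Q :: real^'k^'n) \<in> stiefel"
  shows "norm Q = sqrt CARD('k)"
proof -
  have "Q \<bullet> Q = mat 1 \<bullet> (transpose Q ** Q)"
    using inner_matrix_mult_left[of Q "mat 1" Q] by simp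
  also have "\<dots> = (\<Sum>i\<in>(UNIV::'k set). \<Sum>j\<in>UNIV. if i = j then 1 else 0)"
    using assms unfolding stiefel_def
    by (simp add: inner_vec_def mat_def if_distrib[of "\<lambda>x. x * x"] cong: if_cong)
  finally show ?thesis by (simp add: norm_eq_sqrt_inner)
qed

text \<open>Closed as a preimage, bounded because all elements have the same Frobenius norm.
  Compactness later yields the maximizer in the polar decomposition and the finite nets.\<close>

lemma compact_stiefel: "compact (stiefel :: (real^'k^'n) set)"
proof -
  have "closed ((\<lambda>Q::real^'k^'n. transpose Q ** Q) -` {mat 1})"
    by (intro closed_vimage) (auto simp: transpose_def matrix_matrix_mult_def intro!: continuous_intros)
  then have "closed (stiefel :: (real^'k^'n) set)" by (simp add: stiefel_def vimage_def)
  moreover have "bounded (stiefel :: (real^'k^'n) set)"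
    unfolding bounded_iff by (auto simp: norm_stiefel)
  ultimately show ?thesis by (simp add: compact_eq_bounded_closed)
qed

text \<open>The coordinate embedding of R^k into R^n. An injection \<open>\<rho>\<close> is carried
  along because the row and column index types are unrelated.\<close>

definition frame :: "('k \<Rightarrow> 'n) \<Rightarrow> real^'k^'n" where
  "frame \<rho> = (\<chi> r i. if r = \<rho> i then 1 else 0)"

lemma frame_stiefel:
  assumes "inj \<rho>"
  shows "frame \<rho> \<in> stiefel"
  using assms
  by (auto simp: stiefel_def frame_def transpose_def matrix_matrix_mult_def mat_def vec_eq_iff inj_eq
      if_distrib[of "\<lambda>c. c * _"] cong: if_cong)

lemma exists_inj:
  assumes "CARD('k::finite) \<le> CARD('n::finite)"
  obtains \<rho> :: "'k::finite \<Rightarrow> 'n::finite" where "inj \<rho>"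
  using assms inj_on_iff_card_le[of "UNIV :: ('k::finite) set" "UNIV :: ('n::finite) set"] by auto

text \<open>For a unit vector \<open>v\<close>, the reflection in the hyperplane orthogonal to
  \<open>v\<close>.\<close>

definition householder :: "real^'n \<Rightarrow> real^'n^'n" where
  "householder v = (\<chi> i j. (if i = j then 1 else 0) - 2 * v$i * v$j)"

lemma householder_mult_vec: "householder v *v x = x - (2 * (v \<bullet> x)) *\<^sub>R v"
  by (simp add: householder_def vec_eq_iff matrix_vector_mult_def inner_vec_def left_diff_distrib
      sum_subtractf if_distrib[of "\<lambda>c. c * _"] sum_distrib_left sum_distrib_right cong: if_cong)
    (simp add: mult_ac)

lemma transpose_householder [simp]: "transpose (householder v) = householder v"
  by (simp add: householder_def transpose_def vec_eq_iff)

lemma orthogonal_householder: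
  assumes "norm v = 1"
  shows "orthogonal_matrix (householder v)"
proof -
  have "v \<bullet> v = 1" using assms by (simp add: dot_square_norm)
  then have "v \<bullet> (x - (2 * (v \<bullet> x)) *\<^sub>R v) = - (v \<bullet> x)" for x
    by (simp add: inner_diff_right)
  then have "householder v *v (householder v *v x) = x" for x
    by (simp add: householder_mult_vec)
  then have "householder v ** householder v = mat 1"
    by (simp add: matrix_eq matrix_vector_mul_assoc[symmetric])
  then show ?thesis by (simp add: orthogonal_matrix)
qed

lemma inner_householder: "householder v \<bullet> M = mat 1 \<bullet> M - 2 * (v \<bullet> (M *v v))"
  by (simp add: householder_def inner_vec_def mat_def matrix_vector_mult_def left_diff_distrib
      sum_subtractf sum_distrib_left sum_distrib_right)
    (simp add: mult_ac)

text \<open>Reflections give positivity, products of two reflections give symmetry.\<close>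

lemma pos_semidef_if_maximal:
  fixes M :: "real^'n^'n"
  assumes max: "\<And>U. orthogonal_matrix U \<Longrightarrow> U \<bullet> M \<le> mat 1 \<bullet> M"
  shows "pos_semidef M"
proof -
  have pos1: "0 \<le> v \<bullet> (M *v v)" if "norm v = 1" for v
    using max[OF orthogonal_householder[OF that]] by (simp add: inner_householder)
  have pos: "0 \<le> v \<bullet> (M *v v)" for v
  proof (cases "v = 0")
    case False
    then have "v \<bullet> (M *v v) = (norm v)\<^sup>2 * (((1 / norm v) *\<^sub>R v) \<bullet> (M *v ((1 / norm v) *\<^sub>R v)))"
      by (simp add: matrix_vector_mult_scaleR power2_eq_square)
    also have "\<dots> \<ge> 0" using False by (intro mult_nonneg_nonneg pos1) auto
    finally show ?thesis .
  qed simp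
  \<comment> \<open>Maximality is tested against the product of two reflections, a rotation in the
    plane of \<open>v\<close> and \<open>w\<close> by twice their angle.\<close>
  have two: "2 * (v \<bullet> w) * (v \<bullet> (M *v w)) \<le> v \<bullet> (M *v v) + w \<bullet> (M *v w)"
    if "norm v = 1" "norm w = 1" for v w
  proof -
    have "(householder v ** householder w) \<bullet> M = householder w \<bullet> (householder v ** M)"
      by (simp add: inner_matrix_mult_left)
    also have "\<dots> = mat 1 \<bullet> (householder v ** M) - 2 * (w \<bullet> (householder v *v (M *v w)))"
      by (simp add: inner_householder matrix_vector_mul_assoc)
    also have "mat 1 \<bullet> (householder v ** M) = householder v \<bullet> M"
      using inner_matrix_mult_left[of "householder v" "mat 1" M] by simp
    finally have "(householder v ** householder w) \<bullet> M = mat 1 \<bullet> M - 2 * (v \<bullet> (M *v v))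
        - 2 * (w \<bullet> (M *v w) - 2 * (v \<bullet> (M *v w)) * (v \<bullet> w))"
      by (simp add: inner_householder householder_mult_vec inner_diff_right inner_commute[of w v])
    moreover have "orthogonal_matrix (householder v ** householder w)"
      using that by (intro orthogonal_matrix_mul orthogonal_householder)
    ultimately show ?thesis using max[of "householder v ** householder w"] by (simp add: algebra_simps)
  qed
  have le: "M$i$j \<le> M$j$i" for i j
  proof (rule ccontr)
    assume "\<not> M$i$j \<le> M$j$i"
    define d where "d = M$i$j - M$j$i"
    have d: "d > 0" and ij: "i \<noteq> j" using \<open>\<not> M$i$j \<le> M$j$i\<close> by (auto simp: d_def)
    define e where "e = (\<lambda>i. axis i (1::real) :: real^'n)"
    have ee: "e i \<bullet> e i = 1" "e j \<bullet> e j = 1" "e i \<bullet> e j = 0" "e j \<bullet> e i = 0"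
      using ij by (auto simp: e_def inner_axis_axis)
    have eM: "e a \<bullet> (M *v e b) = M$a$b" for a b
      by (simp add: e_def matrix_vector_mult_basis inner_axis' column_def)
    \<comment> \<open>Turning \<open>w\<close> away from \<open>e i\<close> by a small angle t gains
      about t * d and costs about t^2 * (a - 1). The angle with tangent d / a makes the gain exceed
      the cost; the 1 in \<open>a\<close> makes this strict.\<close>
    define a where "a = M$i$i + M$j$j + 1"
    have a: "a > 0" using pos[of "e i"] pos[of "e j"] by (simp add: eM a_def)
    define r where "r = sqrt (a\<^sup>2 + d\<^sup>2)"
    have r: "r > 0" "r\<^sup>2 = a\<^sup>2 + d\<^sup>2" using a by (auto simp: r_def add_pos_nonneg sum_power2_gt_zero_iff)
    define c s where "c = a / r" and "s = d / r"
    have "c * c + s * s = (a\<^sup>2 + d\<^sup>2) / r\<^sup>2"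
      by (simp add: c_def s_def power2_eq_square add_divide_distrib)
    then have cs: "c * c + s * s = 1" using r a by simp
    define w where "w = c *\<^sub>R e i + s *\<^sub>R e j"
    have w: "norm w = 1"
      using cs by (simp add: norm_eq_sqrt_inner w_def inner_add_left inner_add_right ee)
    have ei: "norm (e i) = 1" by (simp add: norm_eq_sqrt_inner ee)
    have "2 * c * (c * M$i$i + s * M$i$j) \<le> M$i$i + (c * c * M$i$i + c * s * (M$i$j + M$j$i) + s * s * M$j$j)"
      using two[OF ei w]
      by (simp add: w_def inner_add_left inner_add_right ee matrix_vector_right_distrib
          matrix_vector_mult_scaleR eM algebra_simps)
    then have "c * s * d \<le> (1 - c * c) * M$i$i + s * s * M$j$j"
      by (simp add: d_def algebra_simps)
    also have "1 - c * c = s * s" using cs by simp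
    finally have "s * (c * d) \<le> s * (s * (a - 1))" by (simp add: a_def algebra_simps)
    moreover have "s > 0" using d r by (simp add: s_def)
    ultimately have "c * d \<le> s * (a - 1)" by (simp only: mult_le_cancel_left_pos)
    then have "(c * d) * r \<le> (s * (a - 1)) * r" using r by (intro mult_right_mono) auto
    then have "a * d \<le> d * (a - 1)" using r by (simp add: c_def s_def)
    then show False using d by (simp add: algebra_simps)
  qed
  have "transpose M = M" by (simp add: transpose_def vec_eq_iff) (meson le order_antisym)
  with pos show ?thesis by (simp add: pos_semidef_def)
qed

text \<open>\<open>Q\<close> maximizes the inner product with \<open>A\<close> over the Stiefel
  manifold. Varying \<open>Q\<close> from the right makes \<open>transpose Q ** A\<close> positive
  semidefinite; varying it from the left makes \<open>A ** transpose Q\<close> symmetric, and this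
  second symmetry gives A = QP even for rank deficient \<open>A\<close>.\<close>

lemma exists_polar:
  fixes A :: "real^'k^'n"
  assumes "CARD('k) \<le> CARD('n)"
  obtains Q P where "Q \<in> stiefel" "pos_semidef P" "A = Q ** P"
proof -
  obtain \<rho> :: "'k \<Rightarrow> 'n" where "inj \<rho>" using exists_inj[OF assms] by blast
  then have "(stiefel :: (real^'k^'n) set) \<noteq> {}" using frame_stiefel by blast
  then have "\<exists>Q\<in>stiefel. \<forall>Q'\<in>(stiefel :: (real^'k^'n) set). Q' \<bullet> A \<le> Q \<bullet> A"
    by (intro continuous_attains_sup compact_stiefel) (auto intro!: continuous_intros)
  then obtain Q where Q: "Q \<in> stiefel" and max: "\<And>Q' :: real^'k^'n. Q' \<in> stiefel \<Longrightarrow> Q' \<bullet> A \<le> Q \<bullet> A"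
    by blast
  have QQ: "transpose Q ** Q = mat 1" using Q by (simp add: stiefel_def)
  let ?P = "transpose Q ** A" and ?S = "A ** transpose Q"
  have P: "pos_semidef ?P"
  proof (rule pos_semidef_if_maximal)
    fix V :: "real^'k^'k" assume "orthogonal_matrix V"
    then have "(Q ** V) \<bullet> A \<le> (Q ** mat 1) \<bullet> A" using max[OF stiefel_mult_orthogonal[OF Q]] by simp
    then show "V \<bullet> ?P \<le> mat 1 \<bullet> ?P" by (simp only: inner_matrix_mult_left)
  qed
  have S: "pos_semidef ?S"
  proof (rule pos_semidef_if_maximal)
    fix U :: "real^'n^'n" assume "orthogonal_matrix U"
    then have "(U ** Q) \<bullet> A \<le> (mat 1 ** Q) \<bullet> A" using max[OF orthogonal_mult_stiefel[OF _ Q]] by simp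
    then show "U \<bullet> ?S \<le> mat 1 \<bullet> ?S" by (simp only: inner_matrix_mult_right)
  qed
  have "A = ?S ** Q" by (simp add: matrix_mul_assoc[symmetric] QQ)
  also have "\<dots> = transpose ?S ** Q" using S by (simp add: pos_semidef_def)
  also have "\<dots> = Q ** transpose ?P" by (simp add: matrix_transpose_mul matrix_mul_assoc)
  also have "\<dots> = Q ** ?P" using P by (simp add: pos_semidef_def)
  finally show ?thesis using that Q P by blast
qed

section \<open>Square roots and factorizations with a given Gram matrix\<close>

lemma inner_symmetric_matrix:
  fixes B :: "real^'n^'n"
  assumes "transpose B = B"
  shows "x \<bullet> (B *v y) = (B *v x) \<bullet> y"
  using dot_lmul_matrix[of x B y] vector_transpose_matrix[of x B] assms by simp

text \<open>If y = Bx were nonzero, the form would be negative at x - ty for small t > 0: its linear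
  term is -2t (y . y), and the rest is quadratic in t.\<close>

lemma pos_semidef_kernel:
  assumes B: "pos_semidef B" and x: "x \<bullet> (B *v x) = 0"
  shows "B *v x = 0"
proof (rule ccontr)
  assume nz: "B *v x \<noteq> 0"
  define y where "y = B *v x"
  define b where "b = y \<bullet> (B *v y)"
  have yy: "y \<bullet> y > 0" using nz by (simp add: y_def)
  have sym: "transpose B = B" and pos: "\<And>x. 0 \<le> x \<bullet> (B *v x)"
    using B by (auto simp: pos_semidef_def)
  have b: "b \<ge> 0" using pos by (simp add: b_def)
  \<comment> \<open>The minimizing value is (y . y) / b; the added 1 keeps the denominator positive
    when b = 0 and still gives t * b <= y . y.\<close>
  define t where "t = (y \<bullet> y) / (b + 1)"
  have t: "t > 0" using yy b by (simp add: t_def)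
  have xBy: "x \<bullet> (B *v y) = y \<bullet> y"
    using inner_symmetric_matrix[OF sym, of x y] by (simp add: y_def)
  have yBx: "y \<bullet> (B *v x) = y \<bullet> y" by (simp add: y_def)
  have "0 \<le> (x - t *\<^sub>R y) \<bullet> (B *v (x - t *\<^sub>R y))" by (rule pos)
  also have "\<dots> = t * (t * b - 2 * (y \<bullet> y))"
    unfolding matrix_vector_mult_diff_distrib matrix_vector_mult_scaleR inner_diff_left inner_diff_right
    by (simp add: x xBy yBx b_def algebra_simps)
  finally have "2 * (y \<bullet> y) \<le> t * b" using t by (simp add: zero_le_mult_iff)
  moreover have "t * b \<le> y \<bullet> y" using b yy by (simp add: t_def field_simps)
  ultimately show False using yy by simp
qed

text \<open>With \<open>D = B - C\<close> one has \<open>BD + DC = 0\<close>, so \<open>tr(DBD) + tr(DCD) = 0\<close>; both summands are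
  nonnegative, which forces \<open>BD = CD = 0\<close> and hence \<open>D\<^sup>2 = 0\<close>.\<close>

lemma pos_semidef_sqrt_unique:
  fixes B C :: "real^'k^'k"
  assumes B: "pos_semidef B" and C: "pos_semidef C" and eq: "B ** B = C ** C"
  shows "B = C"
proof -
  define D where "D = B - C"
  have sB: "transpose B = B" and sC: "transpose C = C" using B C by (auto simp: pos_semidef_def)
  have sD: "transpose D = D" using sB sC by (simp add: D_def transpose_def vec_eq_iff)
  define e where "e = (\<lambda>i. D *v axis i (1::real))"
  have "B *v (B *v x) = C *v (C *v x)" for x
    using eq by (metis matrix_vector_mul_assoc)
  then have D0: "B ** D + D ** C = 0"
    unfolding D_def matrix_eq
    by (simp add: matrix_vector_mult_add_rdistrib matrix_vector_mult_diff_rdistrib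
        matrix_vector_mult_diff_distrib matrix_vector_mul_assoc[symmetric])
  have quad: "D \<bullet> (S ** D) = (\<Sum>i\<in>UNIV. e i \<bullet> (S *v e i))" for S
  proof -
    have "D \<bullet> (S ** D) = transpose D \<bullet> transpose (S ** D)" by (simp only: inner_transpose)
    also have "\<dots> = (\<Sum>i\<in>UNIV. e i \<bullet> (S *v e i))"
      unfolding e_def matrix_vector_mul_assoc matrix_vector_mult_basis
      by (simp add: inner_vec_def transpose_def column_def matrix_matrix_mult_def matrix_vector_mult_def)
    finally show ?thesis .
  qed
  have "D \<bullet> (B ** D) + D \<bullet> (C ** D) = 0"
  proof -
    have "D \<bullet> (C ** D) = transpose D \<bullet> transpose (C ** D)" by (simp only: inner_transpose)
    also have "\<dots> = D \<bullet> (D ** C)" by (simp add: matrix_transpose_mul sD sC)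
    finally show ?thesis by (simp add: inner_add_right[symmetric] D0)
  qed
  moreover have "0 \<le> e i \<bullet> (B *v e i)" "0 \<le> e i \<bullet> (C *v e i)" for i
    using B C by (auto simp: pos_semidef_def)
  ultimately have "e i \<bullet> (B *v e i) = 0 \<and> e i \<bullet> (C *v e i) = 0" for i
    unfolding quad by (smt (verit, best) UNIV_I finite sum_nonneg sum_nonneg_eq_0_iff)
  then have "B *v e i = 0" "C *v e i = 0" for i
    using pos_semidef_kernel[OF B] pos_semidef_kernel[OF C] by blast+
  then have "D *v e i = 0" for i by (simp add: D_def matrix_vector_mult_diff_rdistrib)
  then have "e i \<bullet> e i = 0" for i
    using inner_symmetric_matrix[OF sD, of "axis i 1" "e i"] by (simp add: e_def)
  then have "D = 0" by (simp add: e_def matrix_vector_mult_basis column_def vec_eq_iff)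
  then show ?thesis by (simp add: D_def)
qed

lemma psd_sqrt_eq:
  assumes "pos_semidef P" "P ** P = A"
  shows "psd_sqrt A = P"
  unfolding psd_sqrt_def
  by (rule the_equality) (use assms pos_semidef_sqrt_unique in auto)

lemma stiefel_mult_gram:
  assumes "Q \<in> stiefel"
  shows "transpose (Q ** T) ** (Q ** T) = transpose T ** T"
proof -
  have "transpose (Q ** T) ** (Q ** T) = transpose T ** (transpose Q ** Q) ** T"
    by (simp add: matrix_transpose_mul matrix_mul_assoc)
  then show ?thesis using assms by (simp add: stiefel_def)
qed

text \<open>Existence of the root is read off from the polar decomposition A = QP, whose Gram matrix
  is P^2.\<close>

lemma psd_sqrt_gram:
  fixes A :: "real^'k^'n"
  assumes "CARD('k) \<le> CARD('n)"
  defines "P \<equiv> psd_sqrt (transpose A ** A)"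
  shows "pos_semidef P" "P ** P = transpose A ** A"
proof -
  obtain Q P' where Q: "Q \<in> stiefel" "pos_semidef P'" "A = Q ** P'"
    using exists_polar[OF assms(1)] by blast
  have "transpose A ** A = P' ** P'"
    using stiefel_mult_gram[OF Q(1), of P'] Q by (simp add: pos_semidef_def)
  moreover from this have "P = P'" unfolding P_def by (intro psd_sqrt_eq Q) simp
  ultimately show "pos_semidef P" "P ** P = transpose A ** A" using Q by auto
qed

text \<open>By uniqueness of the root, \<open>A\<close> and \<open>T\<close> have polar
  decompositions with the same \<open>P\<close>. As \<open>T\<close> is square, its isometric factor
  \<open>V\<close> is orthogonal and can be inverted, whether or not \<open>T\<close> is
  singular.\<close>

lemma stiefel_factor:
  fixes A :: "real^'k^'n" and T :: "real^'k^'k"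
  assumes kn: "CARD('k) \<le> CARD('n)" and eq: "transpose T ** T = transpose A ** A"
  obtains Q where "Q \<in> stiefel" "A = Q ** T"
proof -
  obtain Q P where Q: "Q \<in> stiefel" "pos_semidef P" "A = Q ** P"
    using exists_polar[OF kn] by blast
  obtain V P' where V: "V \<in> stiefel" "pos_semidef P'" "T = V ** P'"
    using exists_polar[of T] by blast
  have "P ** P = transpose A ** A"
    using stiefel_mult_gram[OF Q(1), of P] Q by (simp add: pos_semidef_def)
  moreover have "P' ** P' = transpose T ** T"
    using stiefel_mult_gram[OF V(1), of P'] V by (simp add: pos_semidef_def)
  ultimately have "P' ** P' = P ** P" by (simp only: eq)
  then have P: "P' = P" by (rule pos_semidef_sqrt_unique[OF V(2) Q(2)])
  have oV: "orthogonal_matrix V" using V(1) by (simp add: stiefel_def orthogonal_matrix)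
  then have "(Q ** transpose V) ** T = Q ** ((transpose V ** V) ** P)"
    by (simp only: V(3) P matrix_mul_assoc)
  then have "A = (Q ** transpose V) ** T"
    using oV by (simp add: Q(3) orthogonal_matrix)
  moreover have "Q ** transpose V \<in> stiefel"
    using oV by (intro stiefel_mult_orthogonal Q) simp
  ultimately show ?thesis using that by blast
qed

text \<open>The square matrices \<open>Q ** transpose Q\<close> and \<open>R ** transpose Q\<close>
  have the same Gram matrix, so they differ by an orthogonal left factor \<open>U\<close>;
  multiplying by \<open>Q\<close> from the right leaves \<open>U ** Q = R\<close>.\<close>

lemma stiefel_transitive:
  fixes Q R :: "real^'k^'n"
  assumes Q: "Q \<in> stiefel" and R: "R \<in> stiefel"
  obtains U where "orthogonal_matrix U" "U ** Q = R"
proof -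
  let ?E = "Q ** transpose Q"
  have sE: "transpose ?E = ?E" by (simp add: matrix_transpose_mul)
  have QQ: "transpose Q ** Q = mat 1" using Q by (simp add: stiefel_def)
  have EQ: "?E ** Q = Q" by (simp add: QQ matrix_mul_assoc[symmetric])
  have "?E ** ?E = (?E ** Q) ** transpose Q" by (simp only: matrix_mul_assoc)
  then have "transpose ?E ** ?E = ?E" unfolding sE EQ .
  moreover have "transpose (R ** transpose Q) ** (R ** transpose Q) = ?E"
    using stiefel_mult_gram[OF R, of "transpose Q"] by (simp only: transpose_transpose)
  ultimately have eq: "transpose ?E ** ?E = transpose (R ** transpose Q) ** (R ** transpose Q)"
    by (simp only:)
  obtain U where U: "U \<in> stiefel" "R ** transpose Q = U ** ?E"
    using stiefel_factor[OF order_refl eq] by blast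
  have "U ** Q = (U ** ?E) ** Q" by (simp only: QQ matrix_mul_rid matrix_mul_assoc[symmetric])
  also have "\<dots> = (R ** transpose Q) ** Q" by (simp only: U(2))
  also have "\<dots> = R ** (transpose Q ** Q)" by (simp only: matrix_mul_assoc)
  finally have "U ** Q = R" by (simp only: QQ matrix_mul_rid)
  then show ?thesis using that U(1) by (simp add: stiefel_def orthogonal_matrix)
qed

subsection \<open>Averages of translates\<close>

lemma matrix_diff_ldistrib:
  fixes A :: "real^'m^'n"
  shows "A ** (B - C) = A ** B - A ** C"
  by (simp add: matrix_matrix_mult_def vec_eq_iff right_diff_distrib sum_subtractf)

text \<open>A substitute for averaging over the Haar measure of the orthogonal group: among the functions
  of a class closed under finite averages of translates, one whose maximum over the Stiefel manifold
  is almost minimal is almost constant there, since averaging over translates that move a finite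
  net to a point of small value would lower the maximum.\<close>

lemma exists_flat_average:
  fixes \<mu> :: "(real^'k^'n) measure" and F :: "(real^'k^'n \<Rightarrow> real) set"
  assumes \<mu>: "prob_space \<mu>" "sets \<mu> = sets borel" "AE Q in \<mu>. Q \<in> stiefel"
    and h: "h \<in> F" and L: "L > 0"
    and avg: "\<And>f I U. f \<in> F \<Longrightarrow> finite I \<Longrightarrow> I \<noteq> {} \<Longrightarrow> (\<And>i :: real^'k^'n. orthogonal_matrix (U i)) \<Longrightarrow>
        (\<lambda>A. (\<Sum>i\<in>I. f (U i ** A)) / real (card I)) \<in> F"
    and lip: "\<And>f A B. f \<in> F \<Longrightarrow> \<bar>f A - f B\<bar> \<le> L * norm (A - B)"
    and int: "\<And>f. f \<in> F \<Longrightarrow> (\<integral>Q. f Q \<partial>\<mu>) = c"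
    and \<epsilon>: "\<epsilon> > 0"
  shows "\<exists>f\<in>F. \<forall>Q\<in>stiefel. f Q \<le> c + \<epsilon>"
proof -
  interpret prob_space \<mu> by (rule \<mu>)
  let ?S = "stiefel :: (real^'k^'n) set"
  have "\<exists>Q. Q \<in> ?S"
  proof (rule ccontr)
    assume "\<nexists>Q. Q \<in> ?S"
    then have "AE Q in \<mu>. False" using \<mu>(3) by simp
    then show False by simp
  qed
  then have ne: "?S \<noteq> {}" by blast
  have cont: "continuous_on A f" if "f \<in> F" for f A
  proof -
    have "L-lipschitz_on A f" using lip[OF that] L by (intro lipschitz_onI) (auto simp: dist_norm)
    then show ?thesis by (rule lipschitz_on_continuous_on)
  qed
  have bdd: "bdd_above (f ` ?S)" if "f \<in> F" for f
    by (intro bounded_imp_bdd_above compact_imp_bounded compact_continuous_image cont[OF that] compact_stiefel)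
  define s :: "(real^'k^'n \<Rightarrow> real) \<Rightarrow> real" where "s f = (SUP Q\<in>?S. f Q)" for f
  have s_upper: "f Q \<le> s f" if "f \<in> F" "Q \<in> ?S" for f Q
    unfolding s_def using bdd[OF that(1)] that(2) by (rule cSUP_upper2) simp
  have integrable: "integrable \<mu> f" if f: "f \<in> F" for f
  proof -
    have "bounded (f ` ?S)"
      by (intro compact_imp_bounded compact_continuous_image cont[OF f] compact_stiefel)
    then obtain B where B: "\<And>Q. Q \<in> ?S \<Longrightarrow> norm (f Q) \<le> B" by (auto simp: bounded_iff)
    have "f \<in> borel_measurable \<mu>"
      by (simp add: measurable_cong_sets[OF \<mu>(2) refl] borel_measurable_continuous_onI cont[OF f])
    then show ?thesis using \<mu>(3) B by (intro integrable_const_bound[of _ B]) auto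
  qed
  have c_le: "c \<le> s f" if f: "f \<in> F" for f
  proof -
    have "(\<integral>Q. f Q \<partial>\<mu>) \<le> s f"
      using \<mu>(3) s_upper[OF f] by (intro integral_le_const integrable[OF f]) auto
    then show ?thesis by (simp add: int[OF f])
  qed
  define m where "m = (INF f\<in>F. s f)"
  have m_lower: "m \<le> s f" if "f \<in> F" for f
    unfolding m_def by (rule cINF_lower[OF _ that]) (use c_le in \<open>auto intro!: bdd_belowI[of _ c]\<close>)
  \<comment> \<open>Within distance \<open>r\<close> every function of the class changes by at most
    \<open>\<epsilon> / 2\<close>. The common \<open>L\<close> allows the net to be fixed before
    \<open>f\<close>, whose required precision depends on the size of the net.\<close>
  define r where "r = \<epsilon> / (2 * L)"
  have r: "r > 0" "L * r = \<epsilon> / 2" using \<epsilon> L by (auto simp: r_def)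
  obtain K where K: "finite K" "K \<subseteq> ?S" "?S \<subseteq> (\<Union>P\<in>K. ball P r)"
  proof -
    have "?S \<subseteq> (\<Union>P\<in>?S. ball P r)" using r(1) by auto
    then show ?thesis
      using compactE_image[OF compact_stiefel, of ?S "\<lambda>P. ball P r"] that by (metis open_ball)
  qed
  have K0: "K \<noteq> {}" using K(3) ne by auto
  define N where "N = real (card K)"
  have N: "N > 0" using K(1) K0 by (simp add: N_def card_gt_0_iff)
  \<comment> \<open>Lowering one of \<open>N\<close> summands by \<open>\<epsilon> / 2\<close>
    lowers the average by \<open>\<epsilon> / (2 * N)\<close>, so \<open>f\<close> has to be closer
    to the infimum than that.\<close>
  have "\<exists>f\<in>F. s f < m + \<epsilon> / (2 * N)"
  proof (rule ccontr)
    assume "\<not> ?thesis"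
    then have "m + \<epsilon> / (2 * N) \<le> m"
      unfolding m_def using h by (intro cINF_greatest) (auto simp: not_less)
    moreover have "\<epsilon> / (2 * N) > 0" using \<epsilon> N by simp
    ultimately show False by simp
  qed
  then obtain f where f: "f \<in> F" "s f < m + \<epsilon> / (2 * N)" by blast
  have "s f \<le> c + \<epsilon>"
  proof (cases "\<exists>Q\<in>?S. f Q \<le> s f - \<epsilon>")
    case True
    then obtain R where R: "R \<in> ?S" "f R \<le> s f - \<epsilon>" by blast
    \<comment> \<open>Off the manifold \<open>U\<close> only has to be orthogonal; the identity
      serves as default value.\<close>
    have "\<exists>U. orthogonal_matrix U \<and> (P \<in> ?S \<longrightarrow> U ** P = R)" for P
      using stiefel_transitive[OF _ R(1), of P] orthogonal_matrix_id by metis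
    then obtain U where U: "\<And>P. orthogonal_matrix (U P)" "\<And>P. P \<in> ?S \<Longrightarrow> U P ** P = R"
      by metis
    define g where "g A = (\<Sum>P\<in>K. f (U P ** A)) / real (card K)" for A
    have g: "g \<in> F" unfolding g_def by (rule avg[OF f(1) K(1) K0 U(1)])
    have "g Q \<le> s f - \<epsilon> / (2 * N)" if Q: "Q \<in> ?S" for Q
    proof -
      \<comment> \<open>The translate attached to a net point near \<open>Q\<close> carries
        \<open>Q\<close> close to \<open>R\<close>, where \<open>f\<close> is small; the other
        summands are bounded by the supremum.\<close>
      obtain P where P: "P \<in> K" "dist P Q < r" using K(3) Q by auto
      have PS: "P \<in> ?S" using P K by blast
      have "norm (U P ** Q - R) = norm (U P ** (Q - P))"
        by (simp add: matrix_diff_ldistrib U(2)[OF PS])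
      also have "\<dots> = norm (Q - P)" by (rule norm_orthogonal_mult[OF U(1)])
      also have "\<dots> \<le> r" using P(2) by (simp add: dist_norm norm_minus_commute)
      finally have "L * norm (U P ** Q - R) \<le> \<epsilon> / 2"
        using L r(2) by (metis mult_left_mono order_less_imp_le)
      then have fP: "f (U P ** Q) \<le> s f - \<epsilon> / 2"
        using lip[OF f(1), of "U P ** Q" R] R(2) by linarith
      have "(\<Sum>P\<in>K. f (U P ** Q)) = f (U P ** Q) + (\<Sum>P\<in>K - {P}. f (U P ** Q))"
        using K(1) P(1) by (rule sum.remove)
      also have "\<dots> \<le> (s f - \<epsilon> / 2) + (\<Sum>P\<in>K - {P}. s f)"
        by (intro add_mono fP sum_mono s_upper[OF f(1)] orthogonal_mult_stiefel[OF U(1) Q])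
      also have "\<dots> = N * s f - \<epsilon> / 2"
        using K(1) P(1) K0 by (simp add: N_def card_Diff_singleton of_nat_diff Suc_leI card_gt_0_iff algebra_simps)
      finally show ?thesis using N by (simp add: g_def N_def[symmetric] field_simps)
    qed
    then have "s g \<le> s f - \<epsilon> / (2 * N)" unfolding s_def[of g] using ne by (intro cSUP_least) auto
    with m_lower[OF g] f(2) show ?thesis by simp
  next
    case False
    then have "(\<integral>Q. f Q \<partial>\<mu>) \<ge> s f - \<epsilon>"
      using \<mu>(3) by (intro integral_ge_const integrable[OF f(1)]) (auto elim!: eventually_mono)
    then show ?thesis by (simp add: int[OF f(1)])
  qed
  then show ?thesis using f(1) s_upper[OF f(1)] by (meson order_trans)
qed

subsection \<open>Gaussian vectors\<close>

lemma nn_integral_lborel_shift: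
  fixes f :: "'a::euclidean_space \<Rightarrow> ennreal"
  assumes [measurable]: "f \<in> borel_measurable borel"
  shows "(\<integral>\<^sup>+x. f (t + x) \<partial>lborel) = (\<integral>\<^sup>+x. f x \<partial>lborel)"
  by (subst (2) lborel_distr_plus[symmetric, of t]) (simp add: nn_integral_distr)

lemma nn_integral_lborel_reflect:
  fixes f :: "'a::euclidean_space \<Rightarrow> ennreal"
  assumes [measurable]: "f \<in> borel_measurable borel"
  shows "(\<integral>\<^sup>+x. f (t - x) \<partial>lborel) = (\<integral>\<^sup>+x. f x \<partial>lborel)"
  by (subst (2) lborel_affine[of "-1" t])
    (simp_all add: nn_integral_distr nn_integral_density)

text \<open>Convolving with the indicator of the unit ball and exchanging the integrals compares the
  translation invariant image measure with Lebesgue measure.\<close>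

lemma nn_integral_lborel_orthogonal:
  fixes T :: "'a::euclidean_space \<Rightarrow> 'a"
  assumes T: "orthogonal_transformation T" and [measurable]: "f \<in> borel_measurable borel"
  shows "(\<integral>\<^sup>+x. f (T x) \<partial>lborel) = (\<integral>\<^sup>+x. f x \<partial>lborel)"
proof -
  have lin: "linear T" using T by (rule orthogonal_transformation_linear)
  have [measurable]: "T \<in> borel_measurable borel"
    by (intro borel_measurable_continuous_onI linear_continuous_on linear_conv_bounded_linear[THEN iffD1] lin)
  define g :: "'a \<Rightarrow> ennreal" where "g = indicator (ball 0 1)"
  have [measurable]: "g \<in> borel_measurable borel" unfolding g_def by (intro borel_measurable_indicator) simp
  have gT: "g (T x) = g x" for x
    by (simp add: g_def indicator_def orthogonal_transformation_norm[OF T])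
  have gm: "g (x - y) = g (y - x)" for x y by (simp add: g_def indicator_def norm_minus_commute)
  define b where "b = (\<integral>\<^sup>+x. g x \<partial>lborel)"
  have "b = emeasure lborel (ball (0::'a) 1)" by (simp add: b_def g_def)
  then have b: "b \<noteq> 0" "b < \<top>"
    using emeasure_lborel_ball_finite[of "0::'a" 1]
      content_ball_pos[of 1 "0::'a"] by (auto simp: measure_def)
  \<comment> \<open>This double integral is evaluated twice. Each time, translation invariance frees
    one inner integral of its shift.\<close>
  let ?J = "\<integral>\<^sup>+y. (\<integral>\<^sup>+x. f x * g (T y - x) \<partial>lborel) \<partial>lborel"
  have "?J = (\<integral>\<^sup>+x. (\<integral>\<^sup>+y. f x * g (T y - x) \<partial>lborel) \<partial>lborel)"
    by (rule lborel_pair.Fubini') measurable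
  also have "\<dots> = (\<integral>\<^sup>+x. f x * b \<partial>lborel)"
  proof (rule nn_integral_cong)
    fix x
    \<comment> \<open>Surjectivity turns the shift applied after \<open>T\<close> into a shift of
      the argument of \<open>T\<close>.\<close>
    obtain w where w: "T w = - x" using orthogonal_transformation_surj[OF T] by (metis surjD)
    have "(\<integral>\<^sup>+y. g (T y - x) \<partial>lborel) = (\<integral>\<^sup>+y. g (T (w + y)) \<partial>lborel)"
      by (simp add: linear_add[OF lin] w)
    also have "\<dots> = b" by (simp add: gT nn_integral_lborel_shift b_def)
    finally show "(\<integral>\<^sup>+y. f x * g (T y - x) \<partial>lborel) = f x * b" by (simp add: nn_integral_cmult)
  qed
  also have "\<dots> = (\<integral>\<^sup>+x. f x \<partial>lborel) * b" by (simp add: nn_integral_multc)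
  finally have 1: "?J = (\<integral>\<^sup>+x. f x \<partial>lborel) * b" .
  have "?J = (\<integral>\<^sup>+y. (\<integral>\<^sup>+x. f (T y - x) * g x \<partial>lborel) \<partial>lborel)"
  proof (rule nn_integral_cong)
    fix y
    show "(\<integral>\<^sup>+x. f x * g (T y - x) \<partial>lborel) = (\<integral>\<^sup>+x. f (T y - x) * g x \<partial>lborel)"
      using nn_integral_lborel_reflect[of "\<lambda>x. f x * g (T y - x)" "T y"] by simp
  qed
  also have "\<dots> = (\<integral>\<^sup>+x. (\<integral>\<^sup>+y. f (T y - x) * g x \<partial>lborel) \<partial>lborel)"
    by (rule lborel_pair.Fubini') measurable
  also have "\<dots> = (\<integral>\<^sup>+x. (\<integral>\<^sup>+y. f (T y) \<partial>lborel) * g x \<partial>lborel)"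
  proof (rule nn_integral_cong)
    fix x
    obtain w where w: "T w = - x" using orthogonal_transformation_surj[OF T] by (metis surjD)
    have "(\<integral>\<^sup>+y. f (T y - x) \<partial>lborel) = (\<integral>\<^sup>+y. f (T (w + y)) \<partial>lborel)"
      by (simp add: linear_add[OF lin] w)
    also have "\<dots> = (\<integral>\<^sup>+y. f (T y) \<partial>lborel)" by (rule nn_integral_lborel_shift) measurable
    finally show "(\<integral>\<^sup>+y. f (T y - x) * g x \<partial>lborel) = (\<integral>\<^sup>+y. f (T y) \<partial>lborel) * g x"
      by (simp add: nn_integral_multc)
  qed
  also have "\<dots> = (\<integral>\<^sup>+y. f (T y) \<partial>lborel) * b" by (simp add: nn_integral_cmult b_def)
  finally have "(\<integral>\<^sup>+y. f (T y) \<partial>lborel) * b = (\<integral>\<^sup>+x. f x \<partial>lborel) * b" using 1 by simp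
  then have "(\<integral>\<^sup>+y. f (T y) \<partial>lborel) * (b / b) = (\<integral>\<^sup>+x. f x \<partial>lborel) * (b / b)"
    by (simp add: ennreal_times_divide)
  then show ?thesis using b by (simp add: ennreal_divide_self)
qed

section \<open>The standard Gaussian measure as a product and as a density\<close>

lemma borel_measurable_vecI:
  fixes f :: "'a \<Rightarrow> 'b::euclidean_space^'n"
  assumes "\<And>i. (\<lambda>x. f x $ i) \<in> borel_measurable M"
  shows "f \<in> borel_measurable M"
  unfolding borel_measurable_euclidean_space[of f]
  using assms by (auto simp: Basis_vec_def inner_axis)

lemma borel_measurable_vec_nth [measurable (raw)]:
  fixes f :: "'a \<Rightarrow> 'b::real_normed_vector^'n"
  assumes "f \<in> borel_measurable M"
  shows "(\<lambda>x. f x $ i) \<in> borel_measurable M"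
  by (rule measurable_compose[OF assms])
    (intro borel_measurable_continuous_onI continuous_on_component continuous_on_id)

lemma measurable_vec_lambda [measurable]:
  "vec_lambda \<in> borel_measurable (PiM (UNIV :: 'n::finite set) (\<lambda>_. borel :: real measure))"
  by (rule borel_measurable_vecI) simp

lemma borel_measurable_matrix_vector_mult [measurable]:
  fixes A :: "real^'k^'n"
  shows "(*v) A \<in> borel_measurable borel"
  by (intro borel_measurable_continuous_onI linear_continuous_on linear_conv_bounded_linear[THEN iffD1]
      matrix_vector_mul_linear)

lemma prod_Basis_vec: "(\<Prod>b\<in>Basis. f (b :: real^'n)) = (\<Prod>i\<in>UNIV. f (axis i 1))"
proof -
  have B: "Basis = (\<lambda>i. axis i 1 :: real^'n) ` UNIV" by (auto simp: Basis_vec_def)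
  have "inj (\<lambda>i. axis i 1 :: real^'n)" by (simp add: inj_on_def axis_eq_axis)
  then show ?thesis unfolding B by (subst prod.reindex) simp_all
qed

interpretation lborel_real: product_sigma_finite "\<lambda>_. lborel :: real measure" ..

text \<open>Lebesgue measure is determined by its values on boxes, whose preimages here are products
  of intervals.\<close>

lemma distr_PiM_lborel_vec:
  "distr (PiM (UNIV :: 'n::finite set) (\<lambda>_. lborel)) borel vec_lambda = (lborel :: (real^'n) measure)"
proof (rule lborel_eqI[symmetric])
  fix l u :: "real^'n" assume lu: "\<And>b. b \<in> Basis \<Longrightarrow> l \<bullet> b \<le> u \<bullet> b"
  have le: "l$i \<le> u$i" for i using lu[of "axis i 1"] by (auto simp: inner_axis Basis_vec_def)
  have m: "vec_lambda \<in> borel_measurable (PiM (UNIV :: 'n set) (\<lambda>_. lborel :: real measure))"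
    using measurable_vec_lambda by (simp cong: measurable_cong_sets sets_PiM_cong)
  have eq: "vec_lambda -` box l u \<inter> space (PiM UNIV (\<lambda>_. lborel)) = PiE UNIV (\<lambda>i. {l$i<..<u$i})"
    by (auto simp: mem_box_cart space_PiM PiE_def Pi_def)
  have "emeasure (distr (PiM UNIV (\<lambda>_. lborel)) borel vec_lambda) (box l u)
      = emeasure (PiM UNIV (\<lambda>_. lborel)) (PiE UNIV (\<lambda>i. {l$i<..<u$i}))"
    using m by (simp add: emeasure_distr eq)
  also have "\<dots> = (\<Prod>i\<in>UNIV. ennreal (u$i - l$i))"
    using le by (subst lborel_real.emeasure_PiM) auto
  also have "\<dots> = ennreal (\<Prod>i\<in>UNIV. u$i - l$i)" using le by (intro prod_ennreal) simp
  also have "(\<Prod>i\<in>UNIV. u$i - l$i) = (\<Prod>b\<in>Basis. (u - l) \<bullet> b)"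
    by (simp add: prod_Basis_vec inner_axis)
  finally show "emeasure (distr (PiM UNIV (\<lambda>_. lborel)) borel vec_lambda) (box l u)
      = ennreal (\<Prod>b\<in>Basis. (u - l) \<bullet> b)" .
qed simp

abbreviation stdn :: "real measure" where "stdn \<equiv> std_normal_distribution"

lemma prob_space_stdn: "prob_space stdn"
  by (rule prob_space_normal_density) simp

interpretation stdn: product_sigma_finite "\<lambda>_. stdn"
  unfolding product_sigma_finite_def by (simp add: prob_space_imp_sigma_finite prob_space_stdn)

text \<open>It suffices to compare both measures on rectangles, where the integral of a product
  splits into one-dimensional integrals.\<close>

lemma PiM_stdn_density:
  assumes I: "finite I"
  shows "PiM I (\<lambda>_. stdn) = density (PiM I (\<lambda>_. lborel)) (\<lambda>x. \<Prod>i\<in>I. ennreal (std_normal_density (x i)))"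
proof (rule stdn.PiM_eqI[symmetric])
  show "sets (density (PiM I (\<lambda>_. lborel)) (\<lambda>x. \<Prod>i\<in>I. ennreal (std_normal_density (x i)))) = sets (PiM I (\<lambda>_. stdn))"
    by (simp cong: sets_PiM_cong)
  fix A assume A: "\<And>i. i \<in> I \<Longrightarrow> A i \<in> sets stdn"
  then have A': "\<And>i. i \<in> I \<Longrightarrow> A i \<in> sets borel" by simp
  have "PiE I A \<in> sets (PiM I (\<lambda>_. lborel))" using A' I by (intro sets_PiM_I_finite) auto
  then have "emeasure (density (PiM I (\<lambda>_. lborel)) (\<lambda>x. \<Prod>i\<in>I. ennreal (std_normal_density (x i)))) (PiE I A)
     = (\<integral>\<^sup>+x. (\<Prod>i\<in>I. ennreal (std_normal_density (x i))) * indicator (PiE I A) x \<partial>PiM I (\<lambda>_. lborel))"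
    by (intro emeasure_density) simp_all
  also have "\<dots> = (\<integral>\<^sup>+x. (\<Prod>i\<in>I. ennreal (std_normal_density (x i)) * indicator (A i) (x i)) \<partial>PiM I (\<lambda>_. lborel))"
  proof (rule nn_integral_cong)
    fix x assume "x \<in> space (PiM I (\<lambda>_. lborel :: real measure))"
    then have "indicator (PiE I A) x = (\<Prod>i\<in>I. indicator (A i) (x i) :: ennreal)"
      using I by (cases "x \<in> PiE I A") (auto simp: indicator_def space_PiM PiE_def Pi_def prod_zero_iff)
    then show "(\<Prod>i\<in>I. ennreal (std_normal_density (x i))) * indicator (PiE I A) x =
        (\<Prod>i\<in>I. ennreal (std_normal_density (x i)) * indicator (A i) (x i))"
      by (simp add: prod.distrib)
  qed
  also have "\<dots> = (\<Prod>i\<in>I. \<integral>\<^sup>+x. ennreal (std_normal_density x) * indicator (A i) x \<partial>lborel)"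
    using I A' by (intro lborel_real.product_nn_integral_prod) auto
  also have "\<dots> = (\<Prod>i\<in>I. emeasure stdn (A i))"
    using A' by (intro prod.cong refl emeasure_density[symmetric]) auto
  finally show "emeasure (density (PiM I (\<lambda>_. lborel)) (\<lambda>x. \<Prod>i\<in>I. ennreal (std_normal_density (x i)))) (PiE I A)
      = (\<Prod>i\<in>I. emeasure stdn (A i))" .
qed (rule I)

definition gauss_vec :: "(real^'n) measure" where
  "gauss_vec = distr (PiM UNIV (\<lambda>_. stdn)) borel vec_lambda"

lemma measurable_vec_lambda_stdn [measurable]:
  "vec_lambda \<in> borel_measurable (PiM (UNIV :: 'n::finite set) (\<lambda>_. stdn))"
  using measurable_vec_lambda by (simp cong: measurable_cong_sets sets_PiM_cong)

lemma sets_gauss_vec [simp, measurable_cong]: "sets gauss_vec = sets borel"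
  by (simp add: gauss_vec_def)

lemma prob_space_gauss_vec: "prob_space gauss_vec"
  unfolding gauss_vec_def by (intro prob_space.prob_space_distr prob_space_PiM prob_space_stdn) simp

definition gauss_density :: "real^'n \<Rightarrow> real" where
  "gauss_density y = (1 / sqrt (2 * pi)) ^ CARD('n) * exp (- (norm y)\<^sup>2 / 2)"

lemma prod_std_normal_density:
  fixes y :: "real^'n"
  shows "(\<Prod>i\<in>UNIV. ennreal (std_normal_density (y $ i))) = ennreal (gauss_density y)"
proof -
  have "(\<Prod>i\<in>UNIV. std_normal_density (y $ i)) = (1 / sqrt (2 * pi)) ^ CARD('n) * exp (\<Sum>i\<in>UNIV. - (y$i)\<^sup>2 / 2)"
    unfolding std_normal_density_def prod.distrib by (simp add: exp_sum)
  also have "(\<Sum>i\<in>UNIV. - (y$i)\<^sup>2 / 2) = - (norm y)\<^sup>2 / 2"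
    by (simp add: norm_vec_def L2_set_def sum_nonneg sum_negf sum_divide_distrib)
  finally show ?thesis by (simp add: prod_ennreal gauss_density_def)
qed

text \<open>Rotation invariance, invisible in the product form, becomes apparent here: the density
  depends on the Euclidean norm only.\<close>

lemma gauss_vec_density: "(gauss_vec :: (real^'n) measure) = density lborel (\<lambda>y. ennreal (gauss_density y))"
proof -
  have m: "vec_lambda \<in> borel_measurable (PiM (UNIV :: 'n set) (\<lambda>_. lborel :: real measure))"
    using measurable_vec_lambda by (simp cong: measurable_cong_sets sets_PiM_cong)
  have "(gauss_vec :: (real^'n) measure)
      = distr (density (PiM UNIV (\<lambda>_. lborel)) (\<lambda>x. ennreal (gauss_density (vec_lambda x)))) borel vec_lambda"
    unfolding gauss_vec_def PiM_stdn_density[OF finite] prod_std_normal_density[symmetric] by simp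
  also have "\<dots> = density (distr (PiM UNIV (\<lambda>_. lborel)) borel vec_lambda) (\<lambda>y. ennreal (gauss_density y))"
    using m by (intro density_distr[symmetric]) (simp_all add: gauss_density_def)
  finally show ?thesis by (simp add: distr_PiM_lborel_vec)
qed

lemma orthogonal_matrix_transformation:
  "orthogonal_matrix (U :: real^'n^'n) \<Longrightarrow> orthogonal_transformation ((*v) U)"
  by (simp add: orthogonal_transformation_matrix)

lemma distr_gauss_vec_orthogonal:
  fixes U :: "real^'n^'n"
  assumes U: "orthogonal_matrix U"
  shows "distr gauss_vec borel ((*v) U) = gauss_vec"
proof (rule measure_eqI)
  fix A assume "A \<in> sets (distr gauss_vec borel ((*v) U))"
  then have A [measurable]: "A \<in> sets borel" by simp
  have [measurable]: "(\<lambda>y. ennreal (gauss_density (y :: real^'n))) \<in> borel_measurable borel"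
    by (simp add: gauss_density_def)
  have T: "orthogonal_transformation ((*v) U)" by (rule orthogonal_matrix_transformation[OF U])
  have "emeasure (distr gauss_vec borel ((*v) U)) A = (\<integral>\<^sup>+y. indicator A (U *v y) \<partial>gauss_vec)"
    by (simp add: nn_integral_indicator[symmetric] nn_integral_distr del: nn_integral_indicator)
  also have "\<dots> = (\<integral>\<^sup>+y. ennreal (gauss_density (U *v y)) * indicator A (U *v y) \<partial>lborel)"
    by (simp add: gauss_vec_density nn_integral_density gauss_density_def orthogonal_transformation_norm[OF T])
  also have "\<dots> = (\<integral>\<^sup>+y. ennreal (gauss_density y) * indicator A y \<partial>lborel)"
    by (rule nn_integral_lborel_orthogonal[OF T, of "\<lambda>y. ennreal (gauss_density y) * indicator A y"]) simp
  also have "\<dots> = emeasure gauss_vec A" by (simp add: gauss_vec_density emeasure_density)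
  finally show "emeasure (distr gauss_vec borel ((*v) U)) A = emeasure gauss_vec A" .
qed simp

subsection \<open>Reduction to triangular form\<close>

definition of_columns :: "('k \<Rightarrow> real^'n) \<Rightarrow> real^'k^'n" where
  "of_columns c = (\<chi> r j. c j $ r)"

lemma of_columns_nth [simp]: "of_columns c $ r $ j = c j $ r"
  by (simp add: of_columns_def)

lemma matrix_mult_of_columns: "U ** of_columns c = of_columns (\<lambda>j. U *v c j)"
  by (simp add: vec_eq_iff matrix_matrix_mult_def matrix_vector_mult_def)

lemma measurable_of_columns [measurable (raw)]:
  assumes "\<And>j. c j \<in> borel_measurable M"
  shows "(\<lambda>x. of_columns (\<lambda>j. c j x)) \<in> borel_measurable M"
  by (intro borel_measurable_vecI) (use assms in simp)

text \<open>Built from independent columns, because left multiplication acts on each column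
  separately and the triangular reduction integrates over columns.
  \<open>gaussian_matrix_law\<close> identifies it with the law of independent normal
  entries.\<close>

definition gauss_mat :: "(real^'k^'n) measure" where
  "gauss_mat = distr (PiM UNIV (\<lambda>_. gauss_vec)) borel of_columns"

lemma measurable_of_columns_PiM [measurable]:
  "of_columns \<in> borel_measurable (PiM UNIV (\<lambda>_. gauss_vec))"
  by (rule measurable_of_columns[of "\<lambda>j c. c j"]) measurable

lemma sets_gauss_mat [simp, measurable_cong]: "sets gauss_mat = sets borel"
  by (simp add: gauss_mat_def)

lemma prob_space_gauss_mat: "prob_space gauss_mat"
  unfolding gauss_mat_def
  by (intro prob_space.prob_space_distr prob_space_PiM prob_space_gauss_vec measurable_of_columns_PiM)

text \<open>\<open>J\<close> is arbitrary because the triangular reduction rotates only the columns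
  not yet treated.\<close>

lemma distr_PiM_gauss_vec_orthogonal:
  fixes U :: "real^'n^'n"
  assumes U: "orthogonal_matrix U" and J: "finite J"
  shows "distr (PiM J (\<lambda>_. gauss_vec)) (PiM J (\<lambda>_. gauss_vec)) (\<lambda>c. \<lambda>j\<in>J. U *v c j)
    = PiM J (\<lambda>_. gauss_vec)"
proof -
  have "distr (PiM J (\<lambda>_. gauss_vec)) (PiM J (\<lambda>_. gauss_vec)) (compose J ((*v) U))
      = PiM J (\<lambda>_. distr gauss_vec gauss_vec ((*v) U))"
    by (intro distr_PiM_finite_prob_space' J prob_space_gauss_vec)
      (simp cong: measurable_cong_sets)
  also have "distr gauss_vec gauss_vec ((*v) U) = distr gauss_vec borel ((*v) U)"
    by (rule distr_cong) simp_all
  finally show ?thesis by (simp only: distr_gauss_vec_orthogonal[OF U] compose_def)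
qed

lemma nn_integral_PiM_gauss_vec_orthogonal:
  fixes U :: "real^'n^'n"
  assumes U: "orthogonal_matrix U" and J: "finite J"
    and [measurable]: "f \<in> borel_measurable (PiM J (\<lambda>_. gauss_vec))"
  shows "(\<integral>\<^sup>+c. f (\<lambda>j\<in>J. U *v c j) \<partial>PiM J (\<lambda>_. gauss_vec)) = (\<integral>\<^sup>+c. f c \<partial>PiM J (\<lambda>_. gauss_vec))"
  by (subst (2) distr_PiM_gauss_vec_orthogonal[OF U J, symmetric]) (simp add: nn_integral_distr)

lemma distr_gauss_mat_orthogonal:
  fixes U :: "real^'n^'n"
  assumes U: "orthogonal_matrix U"
  shows "distr gauss_mat borel ((**) U) = (gauss_mat :: (real^'k^'n) measure)"
proof -
  have m: "(**) U \<in> borel_measurable (borel :: (real^'k^'n) measure)"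
    by (intro borel_measurable_continuous_onI) (auto simp: matrix_matrix_mult_def intro!: continuous_intros)
  have m2: "(\<lambda>c. \<lambda>j\<in>UNIV. U *v c j) \<in> PiM UNIV (\<lambda>_::'k. gauss_vec) \<rightarrow>\<^sub>M PiM UNIV (\<lambda>_. gauss_vec)"
    by (intro measurable_restrict) measurable
  have "distr gauss_mat borel ((**) U)
      = distr (PiM UNIV (\<lambda>_::'k. gauss_vec)) borel (\<lambda>c. of_columns (\<lambda>j\<in>UNIV. U *v c j))"
    unfolding gauss_mat_def using m by (subst distr_distr) (simp_all add: comp_def matrix_mult_of_columns restrict_def)
  also have "\<dots> = distr (distr (PiM UNIV (\<lambda>_::'k. gauss_vec)) (PiM UNIV (\<lambda>_. gauss_vec)) (\<lambda>c. \<lambda>j\<in>UNIV. U *v c j))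
      borel of_columns"
    by (subst distr_distr[OF measurable_of_columns_PiM m2]) (simp add: comp_def)
  also have "\<dots> = gauss_mat"
    by (simp only: distr_PiM_gauss_vec_orthogonal[OF U finite] gauss_mat_def)
  finally show ?thesis .
qed

text \<open>The coordinates in the rows of smaller indices are kept; the rest is collapsed to its
  length, put in row \<open>\<rho> j\<close>. For Gaussian \<open>y\<close> this length is the chi
  variable on the diagonal.\<close>

definition triangular_column :: "('k::{finite,linorder} \<Rightarrow> 'n) \<Rightarrow> 'k \<Rightarrow> real^'n \<Rightarrow> real^'n" where
  "triangular_column \<rho> j y = (\<chi> r. if r \<in> \<rho> ` {..<j} then y $ r
     else if r = \<rho> j then sqrt (\<Sum>s\<in>- \<rho> ` {..<j}. (y $ s)\<^sup>2) else 0)"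

lemma measurable_triangular_column [measurable]:
  "triangular_column \<rho> j \<in> borel_measurable borel"
  by (rule borel_measurable_vecI) (simp add: triangular_column_def)

lemma norm_triangular_column:
  assumes "inj \<rho>"
  shows "norm (triangular_column \<rho> j y) = norm y"
proof -
  let ?A = "\<rho> ` {..<j}"
  have j: "\<rho> j \<in> - ?A" using assms by (auto simp: inj_def)
  have "(\<Sum>r\<in>UNIV. (triangular_column \<rho> j y $ r)\<^sup>2)
      = (\<Sum>r\<in>?A. (triangular_column \<rho> j y $ r)\<^sup>2) + (\<Sum>r\<in>- ?A. (triangular_column \<rho> j y $ r)\<^sup>2)"
    by (subst sum.union_disjoint[symmetric]) auto
  also have "(\<Sum>r\<in>?A. (triangular_column \<rho> j y $ r)\<^sup>2) = (\<Sum>r\<in>?A. (y $ r)\<^sup>2)"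
    by (intro sum.cong) (auto simp: triangular_column_def)
  also have "(\<Sum>r\<in>- ?A. (triangular_column \<rho> j y $ r)\<^sup>2)
      = (\<Sum>r\<in>- ?A. if r = \<rho> j then (\<Sum>s\<in>- ?A. (y $ s)\<^sup>2) else 0)"
    by (intro sum.cong) (auto simp: triangular_column_def sum_nonneg)
  also have "\<dots> = (\<Sum>s\<in>- ?A. (y $ s)\<^sup>2)" using j by (simp only: sum.delta finite if_True)
  also have "(\<Sum>r\<in>?A. (y $ r)\<^sup>2) + (\<Sum>r\<in>- ?A. (y $ r)\<^sup>2) = (\<Sum>r\<in>UNIV. (y $ r)\<^sup>2)"
    by (subst sum.union_disjoint[symmetric]) auto
  finally show ?thesis by (simp add: norm_vec_def L2_set_def)
qed

text \<open>Two vectors of equal norm are exchanged by the reflection along their difference. Here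
  the difference vanishes in the rows of indices below \<open>j\<close>, so vectors supported there
  are fixed.\<close>

lemma exists_reflection_triangular_column:
  fixes \<rho> :: "'k::{finite,linorder} \<Rightarrow> 'n::finite" and y :: "real^'n"
  assumes "inj \<rho>"
  shows "\<exists>V. orthogonal_matrix V \<and> V *v y = triangular_column \<rho> j y \<and>
    (\<forall>z. (\<forall>r. r \<notin> \<rho> ` {..<j} \<longrightarrow> z $ r = 0) \<longrightarrow> V *v z = z)"
proof (cases "triangular_column \<rho> j y = y")
  case True
  then show ?thesis by (intro exI[of _ "mat 1"]) (simp add: orthogonal_matrix_id)
next
  case False
  define t where "t = triangular_column \<rho> j y"
  define d where "d = y - t"
  define v where "v = (1 / norm d) *\<^sub>R d"
  have d: "norm d > 0" using False by (simp add: d_def t_def)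
  have "d \<bullet> d = 2 * (d \<bullet> y)"
    using norm_triangular_column[OF assms, of j y]
    by (simp add: d_def inner_diff_left inner_diff_right norm_eq_sqrt_inner inner_commute t_def[symmetric])
  then have dd: "2 * (d \<bullet> y) = norm d * norm d" by (simp add: dot_square_norm power2_eq_square)
  have "householder v *v y = y - ((2 * (d \<bullet> y)) / (norm d * norm d)) *\<^sub>R d"
    by (simp add: householder_mult_vec v_def)
  also have "\<dots> = t" using d unfolding dd by (simp add: d_def)
  finally have "householder v *v y = t" .
  moreover have "householder v *v z = z" if z: "\<forall>r. r \<notin> \<rho> ` {..<j} \<longrightarrow> z $ r = 0" for z
  proof -
    have "d $ r * z $ r = 0" for r
      using z by (cases "r \<in> \<rho> ` {..<j}") (simp_all add: d_def t_def triangular_column_def)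
    then have "d \<bullet> z = 0" unfolding inner_vec_def inner_real_def by (intro sum.neutral) blast
    then show ?thesis by (simp add: householder_mult_vec v_def)
  qed
  moreover have "orthogonal_matrix (householder v)"
    using d by (intro orthogonal_householder) (simp add: v_def)
  ultimately show ?thesis unfolding t_def by blast
qed

interpretation gauss_vec: product_sigma_finite "\<lambda>_. gauss_vec"
  unfolding product_sigma_finite_def by (simp add: prob_space_imp_sigma_finite prob_space_gauss_vec)

text \<open>One column at a time, a reflection that depends on that column only brings it to triangular
  form; it fixes the columns already treated and preserves the law of the remaining ones.\<close>

lemma nn_integral_triangular_columns:
  fixes \<rho> :: "'k::{finite,linorder} \<Rightarrow> 'n::finite" and g :: "real^('k::{finite,linorder})^'n \<Rightarrow> ennreal"
  assumes \<rho>: "inj \<rho>" and g [measurable]: "g \<in> borel_measurable borel"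
    and inv: "\<And>U A. orthogonal_matrix U \<Longrightarrow> g (U ** A) = g A" and "finite A"
  shows "(\<integral>\<^sup>+c. g (of_columns (\<lambda>j. if j \<in> A then triangular_column \<rho> j (c j) else c j)) \<partial>PiM UNIV (\<lambda>_. gauss_vec))
    = (\<integral>\<^sup>+c. g (of_columns c) \<partial>PiM UNIV (\<lambda>_. gauss_vec))"
  using \<open>finite A\<close>
proof (induction A rule: finite_linorder_max_induct)
  case empty
  then show ?case by simp
next
  case (insert b A)
  let ?S = "triangular_column \<rho>"
  define I where "I = insert b A"
  define J where "J = - I"
  have IJ: "I \<inter> J = {}" "I \<union> J = UNIV" by (auto simp: J_def)
  define F where "F B c = g (of_columns (\<lambda>j. if j \<in> B then ?S j (c j) else c j))" for B c
  have F [measurable]: "F B \<in> borel_measurable (PiM UNIV (\<lambda>_. gauss_vec))" for B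
  proof -
    have "(\<lambda>c. if j \<in> B then ?S j (c j) else c j) \<in> borel_measurable (PiM UNIV (\<lambda>_. gauss_vec))" for j
      by (cases "j \<in> B") simp_all
    then show ?thesis unfolding F_def[abs_def] by (intro measurable_compose[OF measurable_of_columns g])
  qed
  \<comment> \<open>By Fubini the columns in \<open>I\<close> are frozen, so the reflection
    determined by column \<open>b\<close> is a constant matrix for the inner integral.\<close>
  have fold: "(\<integral>\<^sup>+c. F B c \<partial>PiM UNIV (\<lambda>_. gauss_vec))
      = (\<integral>\<^sup>+x. (\<integral>\<^sup>+y. F B (merge I J (x, y)) \<partial>PiM J (\<lambda>_. gauss_vec)) \<partial>PiM I (\<lambda>_. gauss_vec))" for B
    using gauss_vec.product_nn_integral_fold[of I J "F B"] IJ by simp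
  have "(\<integral>\<^sup>+c. F I c \<partial>PiM UNIV (\<lambda>_. gauss_vec)) = (\<integral>\<^sup>+c. F A c \<partial>PiM UNIV (\<lambda>_. gauss_vec))"
    unfolding fold
  proof (rule nn_integral_cong)
    fix x :: "'k \<Rightarrow> real^'n" assume x: "x \<in> space (PiM I (\<lambda>_. gauss_vec))"
    obtain V where V: "orthogonal_matrix V" "V *v x b = ?S b (x b)"
      "\<And>z. \<forall>r. r \<notin> \<rho> ` {..<b} \<longrightarrow> z $ r = 0 \<Longrightarrow> V *v z = z"
      using exists_reflection_triangular_column[OF \<rho>, of "x b" b] by blast
    \<comment> \<open>Treated columns are supported in rows of indices up to some j < b, because the
      induction always adds the largest index.\<close>
    have VA: "V *v ?S j (x j) = ?S j (x j)" if "j \<in> A" for j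
    proof (rule V(3), intro allI impI)
      fix r assume "r \<notin> \<rho> ` {..<b}"
      moreover have "j < b" using insert that by blast
      ultimately have "r \<notin> \<rho> ` {..<j}" "r \<noteq> \<rho> j" by auto
      then show "?S j (x j) $ r = 0" by (simp add: triangular_column_def)
    qed
    have bA: "b \<notin> A" using insert by blast
    \<comment> \<open>Inserting \<open>V\<close> does not change \<open>g\<close>; it performs the
      step in column \<open>b\<close> and otherwise survives only as a rotation of the columns in
      \<open>J\<close>.\<close>
    have *: "F A (merge I J (x, y)) = F I (merge I J (x, \<lambda>j\<in>J. V *v y j))" for y
    proof -
      have "F A (merge I J (x, y))
          = g (V ** of_columns (\<lambda>j. if j \<in> A then ?S j (merge I J (x, y) j) else merge I J (x, y) j))"
        by (simp add: F_def inv[OF V(1)])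
      also have "V ** of_columns (\<lambda>j. if j \<in> A then ?S j (merge I J (x, y) j) else merge I J (x, y) j)
          = of_columns (\<lambda>j. if j \<in> I then ?S j (merge I J (x, \<lambda>j\<in>J. V *v y j) j) else merge I J (x, \<lambda>j\<in>J. V *v y j) j)"
        unfolding matrix_mult_of_columns
        by (rule arg_cong[of _ _ of_columns]) (auto simp: I_def J_def merge_def VA V(2) bA)
      finally show ?thesis by (simp only: F_def)
    qed
    have "(\<lambda>y. F I (merge I J (x, y))) \<in> borel_measurable (PiM J (\<lambda>_. gauss_vec))"
    proof -
      have "(\<lambda>y. merge I J (x, y)) \<in> PiM J (\<lambda>_. gauss_vec) \<rightarrow>\<^sub>M PiM (I \<union> J) (\<lambda>_. gauss_vec)"
        using x by measurable
      then show ?thesis using IJ(2) by (intro measurable_compose[OF _ F]) simp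
    qed
    from nn_integral_PiM_gauss_vec_orthogonal[OF V(1) finite this]
    show "(\<integral>\<^sup>+y. F I (merge I J (x, y)) \<partial>PiM J (\<lambda>_. gauss_vec))
        = (\<integral>\<^sup>+y. F A (merge I J (x, y)) \<partial>PiM J (\<lambda>_. gauss_vec))"
      by (simp add: *)
  qed
  then show ?case using insert.IH by (simp add: F_def I_def)
qed

text \<open>Formed directly from the entries of \<open>A\<close>, this is in general not the QR
  factor of \<open>A\<close> and has another Gram matrix. It replaces that factor only in the mean
  over Gaussian \<open>A\<close>, in the sense of
  \<open>nn_integral_triangular_factor\<close>.\<close>

definition triangular_factor :: "('k::{finite,linorder} \<Rightarrow> 'n) \<Rightarrow> real^('k::{finite,linorder})^'n \<Rightarrow> real^('k::{finite,linorder})^('k::{finite,linorder})" where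
  "triangular_factor \<rho> A = (\<chi> i j. if i < j then A $ \<rho> i $ j
     else if i = j then sqrt (\<Sum>s\<in>- \<rho> ` {..<j}. (A $ s $ j)\<^sup>2) else 0)"

lemma frame_mult_triangular_factor:
  assumes \<rho>: "inj \<rho>"
  shows "frame \<rho> ** triangular_factor \<rho> (of_columns c) = of_columns (\<lambda>j. triangular_column \<rho> j (c j))"
proof -
  have "(\<Sum>i\<in>UNIV. frame \<rho> $ r $ i * triangular_factor \<rho> (of_columns c) $ i $ j)
      = triangular_column \<rho> j (c j) $ r" for r j
  proof (cases "r \<in> range \<rho>")
    case True
    then obtain i where r: "r = \<rho> i" by blast
    have "(\<Sum>i\<in>UNIV. frame \<rho> $ r $ i * triangular_factor \<rho> (of_columns c) $ i $ j)
        = (\<Sum>i'\<in>UNIV. if i' = i then triangular_factor \<rho> (of_columns c) $ i' $ j else 0)"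
      using \<rho> by (intro sum.cong) (auto simp: frame_def r inj_eq)
    also have "\<dots> = triangular_column \<rho> j (c j) $ r"
      using \<rho> by (auto simp: triangular_factor_def triangular_column_def r inj_eq inj_image_mem_iff)
    finally show ?thesis .
  next
    case False
    then show ?thesis by (auto simp: frame_def triangular_column_def intro!: sum.neutral)
  qed
  then show ?thesis by (simp add: vec_eq_iff matrix_matrix_mult_def)
qed

lemma nn_integral_triangular_factor:
  fixes \<rho> :: "'k::{finite,linorder} \<Rightarrow> 'n::finite" and g :: "real^('k::{finite,linorder})^'n \<Rightarrow> ennreal"
  assumes \<rho>: "inj \<rho>" and g [measurable]: "g \<in> borel_measurable borel"
    and inv: "\<And>U A. orthogonal_matrix U \<Longrightarrow> g (U ** A) = g A"
  shows "(\<integral>\<^sup>+A. g (frame \<rho> ** triangular_factor \<rho> A) \<partial>gauss_mat) = (\<integral>\<^sup>+A. g A \<partial>gauss_mat)"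
proof -
  have m: "(\<lambda>A. g (frame \<rho> ** triangular_factor \<rho> A)) \<in> borel_measurable borel"
    by (intro measurable_compose[OF _ g] borel_measurable_vecI)
      (simp add: matrix_matrix_mult_def triangular_factor_def)
  show ?thesis
    unfolding gauss_mat_def
    using nn_integral_triangular_columns[OF \<rho> g inv, of UNIV] m
    by (simp add: nn_integral_distr frame_mult_triangular_factor[OF \<rho>])
qed

subsection \<open>Laws of the factors\<close>

lemma distributed_std_normal_distr:
  assumes "distributed M lborel X std_normal_density"
  shows "distr M borel X = stdn"
  using distributed_distr_eq_density[OF assms] distr_cong[of M M borel lborel X X] by simp

lemma gaussian_matrixD:
  fixes \<Gamma> :: "'w \<Rightarrow> real^'k^'n"
  assumes M: "prob_space M" and g: "gaussian_matrix M 1 \<Gamma>"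
  shows gaussian_matrix_indep: "prob_space.indep_vars M (\<lambda>_. borel) (\<lambda>p \<omega>. \<Gamma> \<omega> $ fst p $ snd p) UNIV"
    and gaussian_matrix_entry: "distr M borel (\<lambda>\<omega>. \<Gamma> \<omega> $ i $ j) = stdn"
    and gaussian_matrix_entry_measurable: "(\<lambda>\<omega>. \<Gamma> \<omega> $ i $ j) \<in> borel_measurable M"
    and gaussian_matrix_measurable: "\<Gamma> \<in> borel_measurable M"
    and gaussian_matrix_entry_integrable: "integrable M (\<lambda>\<omega>. \<bar>\<Gamma> \<omega> $ i $ j\<bar>)"
proof -
  interpret prob_space M by (rule M)
  have d: "distributed M lborel (\<lambda>\<omega>. \<Gamma> \<omega> $ i $ j) std_normal_density" for i j
    using g by (simp add: gaussian_matrix_def)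
  show "indep_vars (\<lambda>_. borel) (\<lambda>p \<omega>. \<Gamma> \<omega> $ fst p $ snd p) UNIV"
    using g by (simp add: gaussian_matrix_def case_prod_beta')
  show "distr M borel (\<lambda>\<omega>. \<Gamma> \<omega> $ i $ j) = stdn" by (rule distributed_std_normal_distr[OF d])
  have m: "(\<lambda>\<omega>. \<Gamma> \<omega> $ i $ j) \<in> borel_measurable M" for i j
    using distributed_measurable[OF d] by simp
  then show "(\<lambda>\<omega>. \<Gamma> \<omega> $ i $ j) \<in> borel_measurable M" .
  show "\<Gamma> \<in> borel_measurable M" by (intro borel_measurable_vecI m)
  show "integrable M (\<lambda>\<omega>. \<bar>\<Gamma> \<omega> $ i $ j\<bar>)"
  proof (rule distributed_integrable[OF d[of i j], of abs, THEN iffD1])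
    show "integrable lborel (\<lambda>x. std_normal_density x * \<bar>x\<bar>)"
      using integrable_normal_moment_abs[where \<mu> = 0 and \<sigma> = 1 and k = 1] by simp
  qed simp_all
qed

lemma gaussian_matrix_joint:
  fixes \<Gamma> :: "'w \<Rightarrow> real^'k^'n"
  assumes M: "prob_space M" and g: "gaussian_matrix M 1 \<Gamma>"
  shows "distr M (PiM UNIV (\<lambda>_. stdn)) (\<lambda>\<omega> p. \<Gamma> \<omega> $ fst p $ snd p) = PiM UNIV (\<lambda>_. stdn)"
proof -
  interpret prob_space M by (rule M)
  note ind = gaussian_matrix_indep[OF M g]
  have "distr M (PiM UNIV (\<lambda>_. borel)) (\<lambda>\<omega>. \<lambda>p\<in>UNIV. \<Gamma> \<omega> $ fst p $ snd p)
      = PiM UNIV (\<lambda>p. distr M borel (\<lambda>\<omega>. \<Gamma> \<omega> $ fst p $ snd p))"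
    using ind by (subst (asm) indep_vars_iff_distr_eq_PiM) (auto intro: gaussian_matrix_entry_measurable[OF M g])
  then have "distr M (PiM UNIV (\<lambda>_. borel)) (\<lambda>\<omega> p. \<Gamma> \<omega> $ fst p $ snd p) = PiM UNIV (\<lambda>_. stdn)"
    by (simp add: gaussian_matrix_entry[OF M g] restrict_def)
  moreover have "distr M (PiM UNIV (\<lambda>_. borel)) (\<lambda>\<omega> p. \<Gamma> \<omega> $ fst p $ snd p)
      = distr M (PiM UNIV (\<lambda>_. stdn)) (\<lambda>\<omega> p. \<Gamma> \<omega> $ fst p $ snd p)"
    by (intro distr_cong refl sets_PiM_cong) simp
  ultimately show ?thesis by simp
qed

text \<open>Restricting a product of equal probability measures along an injection gives such a
  product again. It is used for whole columns and for the part of a column that forms a diagonal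
  entry.\<close>

lemma gaussian_matrix_subfamily:
  fixes \<Gamma> :: "'w \<Rightarrow> real^'k^'n"
  assumes M: "prob_space M" and g: "gaussian_matrix M 1 \<Gamma>" and f: "inj_on f I"
  shows "distr M (PiM I (\<lambda>_. stdn)) (\<lambda>\<omega>. \<lambda>i\<in>I. \<Gamma> \<omega> $ fst (f i) $ snd (f i)) = PiM I (\<lambda>_. stdn)"
proof -
  have m: "(\<lambda>\<omega> p. \<Gamma> \<omega> $ fst p $ snd p) \<in> M \<rightarrow>\<^sub>M PiM UNIV (\<lambda>_. stdn)"
    using measurable_restrict[of UNIV "\<lambda>p \<omega>. \<Gamma> \<omega> $ fst p $ snd p" M "\<lambda>_. stdn"]
      gaussian_matrix_entry_measurable[OF M g] by (simp add: restrict_def)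
  have m2: "(\<lambda>\<omega>. \<lambda>i\<in>I. \<omega> (f i)) \<in> PiM UNIV (\<lambda>_. stdn) \<rightarrow>\<^sub>M PiM I (\<lambda>_. stdn)"
    by (intro measurable_restrict measurable_component_singleton) simp
  have "PiM I (\<lambda>_. stdn) = distr (PiM UNIV (\<lambda>_. stdn)) (PiM I (\<lambda>_. stdn)) (\<lambda>\<omega>. \<lambda>i\<in>I. \<omega> (f i))"
    using distr_PiM_reindex[OF prob_space_stdn f, of UNIV] by simp
  also have "\<dots> = distr (distr M (PiM UNIV (\<lambda>_. stdn)) (\<lambda>\<omega> p. \<Gamma> \<omega> $ fst p $ snd p))
      (PiM I (\<lambda>_. stdn)) (\<lambda>\<omega>. \<lambda>i\<in>I. \<omega> (f i))"
    by (simp only: gaussian_matrix_joint[OF M g])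
  also have "\<dots> = distr M (PiM I (\<lambda>_. stdn)) (\<lambda>\<omega>. \<lambda>i\<in>I. \<Gamma> \<omega> $ fst (f i) $ snd (f i))"
    unfolding distr_distr[OF m2 m] by (simp add: comp_def)
  finally show ?thesis by simp
qed

lemma gaussian_matrix_column:
  fixes \<Gamma> :: "'w \<Rightarrow> real^'k^'n"
  assumes M: "prob_space M" and g: "gaussian_matrix M 1 \<Gamma>"
  shows "distr M borel (\<lambda>\<omega>. \<chi> i. \<Gamma> \<omega> $ i $ j) = gauss_vec"
proof -
  have m: "(\<lambda>\<omega>. \<lambda>i\<in>UNIV. \<Gamma> \<omega> $ i $ j) \<in> M \<rightarrow>\<^sub>M PiM UNIV (\<lambda>_. stdn)"
    using gaussian_matrix_entry_measurable[OF M g] by (intro measurable_restrict) simp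
  have "inj (\<lambda>i. (i, j))" by (simp add: inj_on_def)
  from gaussian_matrix_subfamily[OF M g this]
  have "gauss_vec = distr (distr M (PiM UNIV (\<lambda>_. stdn)) (\<lambda>\<omega>. \<lambda>i\<in>UNIV. \<Gamma> \<omega> $ i $ j)) borel vec_lambda"
    unfolding gauss_vec_def by (simp only: fst_conv snd_conv)
  also have "\<dots> = distr M borel (vec_lambda \<circ> (\<lambda>\<omega>. \<lambda>i\<in>UNIV. \<Gamma> \<omega> $ i $ j))"
    by (rule distr_distr[OF measurable_vec_lambda_stdn m])
  finally show ?thesis by (simp add: comp_def restrict_def)
qed

text \<open>Distinct columns use disjoint blocks of entries, hence are independent, and each has law
  \<open>gauss_vec\<close>.\<close>

lemma gaussian_matrix_law:
  fixes \<Gamma> :: "'w \<Rightarrow> real^'k^'n"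
  assumes M: "prob_space M" and g: "gaussian_matrix M 1 \<Gamma>"
  shows "distr M borel \<Gamma> = gauss_mat"
proof -
  interpret prob_space M by (rule M)
  let ?K = "\<lambda>j. (UNIV :: 'n set) \<times> {j :: 'k}" and ?c = "\<lambda>j \<omega>. \<chi> i. \<Gamma> \<omega> $ i $ j"
  have "indep_vars (\<lambda>j. PiM (?K j) (\<lambda>_. borel)) (\<lambda>j \<omega>. \<lambda>p\<in>?K j. \<Gamma> \<omega> $ fst p $ snd p) UNIV"
    by (rule indep_vars_restrict[OF gaussian_matrix_indep[OF M g]]) (auto simp: disjoint_family_on_def)
  then have "indep_vars (\<lambda>_. borel) (\<lambda>j \<omega>. (\<lambda>x. \<chi> i. x (i, j)) (\<lambda>p\<in>?K j. \<Gamma> \<omega> $ fst p $ snd p)) UNIV"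
  proof (rule indep_vars_compose2)
    fix j
    show "(\<lambda>x. \<chi> i. x (i, j)) \<in> borel_measurable (PiM (?K j) (\<lambda>_. borel :: real measure))"
      by (rule borel_measurable_vecI) simp
  qed
  then have "indep_vars (\<lambda>_. borel) ?c UNIV" by simp
  moreover have mc: "?c j \<in> borel_measurable M" for j
    by (rule borel_measurable_vecI) (simp add: gaussian_matrix_entry_measurable[OF M g])
  ultimately have "distr M (PiM UNIV (\<lambda>_. borel)) (\<lambda>\<omega>. \<lambda>j\<in>UNIV. ?c j \<omega>) = PiM UNIV (\<lambda>_. gauss_vec)"
    by (subst (asm) indep_vars_iff_distr_eq_PiM) (simp_all add: gaussian_matrix_column[OF M g])
  then have eq: "PiM UNIV (\<lambda>_. gauss_vec) = distr M (PiM UNIV (\<lambda>_. borel)) (\<lambda>\<omega>. \<lambda>j\<in>UNIV. ?c j \<omega>)" by simp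
  have m: "(\<lambda>\<omega>. \<lambda>j\<in>UNIV. ?c j \<omega>) \<in> M \<rightarrow>\<^sub>M PiM UNIV (\<lambda>_. borel)"
    by (intro measurable_restrict mc)
  have m2: "of_columns \<in> borel_measurable (PiM UNIV (\<lambda>_ :: 'k. borel :: (real^'n) measure))"
    by (rule measurable_of_columns[of "\<lambda>j c. c j"]) simp
  have "of_columns (\<lambda>j\<in>UNIV. ?c j \<omega>) = \<Gamma> \<omega>" for \<omega> by (simp add: vec_eq_iff)
  then show ?thesis by (simp add: gauss_mat_def eq distr_distr[OF m2 m] comp_def)
qed

lemma chi_square_gaussian_column:
  fixes \<Gamma> :: "'w \<Rightarrow> real^'k^'n"
  assumes M: "prob_space M" and g: "gaussian_matrix M 1 \<Gamma>"
  shows "distr M borel (\<lambda>\<omega>. \<Sum>s\<in>S. (\<Gamma> \<omega> $ s $ j)\<^sup>2) = chi_square (card S)"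
proof -
  obtain e where e: "bij_betw e {..<card S} S"
    using ex_bij_betw_nat_finite[of S] by (auto simp: atLeast0LessThan)
  let ?f = "\<lambda>i. (e i, j)"
  have inj: "inj_on ?f {..<card S}" using e by (auto simp: bij_betw_def inj_on_def)
  have m: "(\<lambda>\<omega>. \<lambda>i\<in>{..<card S}. \<Gamma> \<omega> $ e i $ j) \<in> M \<rightarrow>\<^sub>M PiM {..<card S} (\<lambda>_. stdn)"
    using gaussian_matrix_entry_measurable[OF M g] by (intro measurable_restrict) simp
  have m2: "(\<lambda>x. \<Sum>i<card S. (x i)\<^sup>2) \<in> borel_measurable (PiM {..<card S} (\<lambda>_. stdn))"
    by (intro borel_measurable_sum borel_measurable_power) (simp_all cong: measurable_cong_sets)
  have "chi_square (card S) = distr (distr M (PiM {..<card S} (\<lambda>_. stdn))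
      (\<lambda>\<omega>. \<lambda>i\<in>{..<card S}. \<Gamma> \<omega> $ e i $ j)) borel (\<lambda>x. \<Sum>i<card S. (x i)\<^sup>2)"
    using gaussian_matrix_subfamily[OF M g inj] by (simp add: chi_square_def)
  also have "\<dots> = distr M borel (\<lambda>\<omega>. \<Sum>i<card S. (\<Gamma> \<omega> $ e i $ j)\<^sup>2)"
    unfolding distr_distr[OF m2 m] by (simp add: comp_def)
  also have "(\<lambda>\<omega>. \<Sum>i<card S. (\<Gamma> \<omega> $ e i $ j)\<^sup>2) = (\<lambda>\<omega>. \<Sum>s\<in>S. (\<Gamma> \<omega> $ s $ j)\<^sup>2)"
    by (intro ext sum.reindex_bij_betw[OF e])
  finally show ?thesis by simp
qed

lemma measurable_triangular_factor [measurable]: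
  "triangular_factor \<rho> \<in> borel_measurable borel"
  by (intro borel_measurable_vecI) (simp add: triangular_factor_def)

lemma chi_normal_triangular_factor:
  fixes \<rho> :: "'k::{finite,linorder} \<Rightarrow> 'n::finite" and \<Gamma> :: "'w \<Rightarrow> real^('k::{finite,linorder})^'n"
  assumes M: "prob_space M" and g: "gaussian_matrix M 1 \<Gamma>" and \<rho>: "inj \<rho>"
  shows "chi_normal_triangular M CARD('n) (\<lambda>\<omega>. triangular_factor \<rho> (\<Gamma> \<omega>))"
proof -
  interpret prob_space M by (rule M)
  let ?R = "\<lambda>\<omega>. triangular_factor \<rho> (\<Gamma> \<omega>)" and ?I = "{(i :: 'k, j). i \<le> j}"
  \<comment> \<open>\<open>K p\<close> collects the entries of \<open>\<Gamma>\<close> from which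
    \<open>f p\<close> computes entry \<open>p\<close> of the factor; independence follows from
    disjointness of these blocks.\<close>
  define K where "K p = (case p of (i, j) \<Rightarrow> if i < j then {(\<rho> i, j)} else (- \<rho> ` {..<j}) \<times> {j})" for p
  define f where "f p x = (case p of (i, j) \<Rightarrow> if i < j then x (\<rho> i, j)
      else sqrt (\<Sum>s\<in>- \<rho> ` {..<j}. (x (s, j))\<^sup>2))" for p and x :: "'n \<times> 'k \<Rightarrow> real"
  have disj: "disjoint_family_on K ?I"
    using \<rho> by (auto simp: disjoint_family_on_def K_def inj_eq split: if_splits)
  have fm: "f p \<in> borel_measurable (PiM (K p) (\<lambda>_. borel))" if "p \<in> ?I" for p
    using that by (cases p) (auto simp: f_def[abs_def] K_def
        intro!: borel_measurable_sum borel_measurable_power measurable_component_singleton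
          measurable_compose[OF _ borel_measurable_sqrt])
  have feq: "f p (\<lambda>q\<in>K p. \<Gamma> \<omega> $ fst q $ snd q) = ?R \<omega> $ fst p $ snd p" if "p \<in> ?I" for p \<omega>
    using that by (cases p) (auto simp: f_def K_def triangular_factor_def)
  have "indep_vars (\<lambda>p. PiM (K p) (\<lambda>_. borel)) (\<lambda>p \<omega>. \<lambda>q\<in>K p. \<Gamma> \<omega> $ fst q $ snd q) ?I"
    by (rule indep_vars_restrict[OF gaussian_matrix_indep[OF M g] _ disj]) simp
  from indep_vars_compose2[OF this, of f "\<lambda>_. borel"] fm
  have "indep_vars (\<lambda>_. borel) (\<lambda>p \<omega>. f p (\<lambda>q\<in>K p. \<Gamma> \<omega> $ fst q $ snd q)) ?I" by blast
  then have ind: "indep_vars (\<lambda>_. borel) (\<lambda>(i, j) \<omega>. ?R \<omega> $ i $ j) ?I"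
    by (rule indep_vars_cong[THEN iffD1, rotated -1]) (auto simp: feq)
  \<comment> \<open>The truncated subtraction gives the right count because injectivity of
    \<open>\<rho>\<close> ensures \<open>card {..i} \<le> CARD('n)\<close>.\<close>
  have c: "card (- \<rho> ` {..<i}) = CARD('n) - card {..i} + 1" for i
  proof -
    have "{..i} = insert i {..<i}" by auto
    then have 1: "card {..i} = Suc (card {..<i})" by simp
    have 2: "card (\<rho> ` {..<i}) = card {..<i}"
      using \<rho> by (intro card_image) (auto simp: inj_on_def)
    have "card {..i} = card (\<rho> ` {..i})"
      using \<rho> by (intro card_image[symmetric]) (auto simp: inj_on_def)
    also have "\<dots> \<le> CARD('n)" by (intro card_mono) auto
    finally show ?thesis using 1 2 by (simp add: Compl_eq_Diff_UNIV card_Diff_subset)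
  qed
  have sq: "(?R \<omega> $ i $ i)\<^sup>2 = (\<Sum>s\<in>- \<rho> ` {..<i}. (\<Gamma> \<omega> $ s $ i)\<^sup>2)" for \<omega> i
    by (simp add: triangular_factor_def sum_nonneg)
  have up: "?R \<omega> $ i $ j = \<Gamma> \<omega> $ \<rho> i $ j" if "i < j" for \<omega> i j
    using that by (simp add: triangular_factor_def)
  have d: "distributed M lborel (\<lambda>\<omega>. \<Gamma> \<omega> $ i $ j) std_normal_density" for i j
    using g by (simp add: gaussian_matrix_def)
  show ?thesis
    unfolding chi_normal_triangular_def
  proof (intro conjI allI impI)
    show "?R \<in> borel_measurable M"
      by (rule measurable_compose[OF gaussian_matrix_measurable[OF M g] measurable_triangular_factor])
    show "AE \<omega> in M. 0 \<le> ?R \<omega> $ i $ i" for i by (simp add: triangular_factor_def sum_nonneg)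
    show "distr M borel (\<lambda>\<omega>. (?R \<omega> $ i $ i)\<^sup>2) = chi_square (CARD('n) - card {..i} + 1)" for i
      unfolding sq c[symmetric] by (rule chi_square_gaussian_column[OF M g])
    show "distributed M lborel (\<lambda>\<omega>. ?R \<omega> $ i $ j) std_normal_density" if "i < j" for i j
      using d by (simp add: up[OF that])
    show "AE \<omega> in M. ?R \<omega> $ i $ j = 0" if "j < i" for i j
      using that by (simp add: triangular_factor_def)
  qed (rule ind)
qed

text \<open>An explicit measure through which triangular matrices on different probability spaces
  are compared.\<close>

definition chi_normal_law :: "nat \<Rightarrow> (real^('k::{finite,linorder})^('k::{finite,linorder})) measure" where
  "chi_normal_law n = distr (PiM {(i, j). i \<le> j} (\<lambda>(i, j). if i < j then stdn
      else distr (chi_square (n - card {..i} + 1)) borel sqrt)) borel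
     (\<lambda>x. \<chi> i j. if i \<le> j then x (i, j) else 0)"

text \<open>Independence and the marginals determine the joint law on and above the diagonal; the
  remaining entries vanish almost surely.\<close>

lemma chi_normal_triangular_law:
  fixes R :: "'w \<Rightarrow> real^('k::{finite,linorder})^('k::{finite,linorder})"
  assumes M: "prob_space M" and R: "chi_normal_triangular M n R"
  shows "distr M borel R = chi_normal_law n"
proof -
  interpret prob_space M by (rule M)
  let ?I = "{(i :: 'k, j). i \<le> j}"
  let ?b = "\<lambda>x. (\<chi> i j. if i \<le> j then x (i, j) else 0) :: real^('k::{finite,linorder})^('k::{finite,linorder})"
  let ?N = "\<lambda>(i :: 'k, j). if i < j then stdn else distr (chi_square (n - card {..i} + 1)) borel sqrt"
  have Rm [measurable]: "R \<in> borel_measurable M"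
    and ind: "indep_vars (\<lambda>_. borel) (\<lambda>p \<omega>. R \<omega> $ fst p $ snd p) ?I"
    and nn: "\<And>i. AE \<omega> in M. 0 \<le> R \<omega> $ i $ i"
    and sq: "\<And>i. distr M borel (\<lambda>\<omega>. (R \<omega> $ i $ i)\<^sup>2) = chi_square (n - card {..i} + 1)"
    and up: "\<And>i j. i < j \<Longrightarrow> distributed M lborel (\<lambda>\<omega>. R \<omega> $ i $ j) std_normal_density"
    and low: "\<And>i j. j < i \<Longrightarrow> AE \<omega> in M. R \<omega> $ i $ j = 0"
    using R by (auto simp: chi_normal_triangular_def case_prod_beta')
  have law: "distr M borel (\<lambda>\<omega>. R \<omega> $ fst p $ snd p) = ?N p" if "p \<in> ?I" for p
  proof (cases "fst p < snd p")
    case True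
    then show ?thesis using distributed_std_normal_distr[OF up] by (simp add: case_prod_beta)
  next
    case False
    with that have p: "p = (fst p, fst p)" by (auto simp: prod_eq_iff)
    let ?i = "fst p"
    \<comment> \<open>Only the law of the square is prescribed; almost sure nonnegativity recovers
      the entry as its square root.\<close>
    have "distr M borel (\<lambda>\<omega>. R \<omega> $ ?i $ ?i) = distr M borel (\<lambda>\<omega>. sqrt ((R \<omega> $ ?i $ ?i)\<^sup>2))"
      by (rule distr_cong_AE) (use nn[of ?i] in \<open>auto elim!: eventually_mono\<close>)
    also have "\<dots> = distr (distr M borel (\<lambda>\<omega>. (R \<omega> $ ?i $ ?i)\<^sup>2)) borel sqrt"
      by (subst distr_distr) (simp_all add: comp_def)
    finally show ?thesis unfolding sq by (subst (2) p, subst p) simp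
  qed
  have "distr M (PiM ?I (\<lambda>_. borel)) (\<lambda>\<omega>. \<lambda>p\<in>?I. R \<omega> $ fst p $ snd p)
      = PiM ?I (\<lambda>p. distr M borel (\<lambda>\<omega>. R \<omega> $ fst p $ snd p))"
    using ind by (subst (asm) indep_vars_iff_distr_eq_PiM) (auto intro!: exI[of _ undefined])
  also have "\<dots> = PiM ?I ?N" using law by (intro PiM_cong) auto
  finally have eq: "PiM ?I ?N = distr M (PiM ?I (\<lambda>_. borel)) (\<lambda>\<omega>. \<lambda>p\<in>?I. R \<omega> $ fst p $ snd p)" ..
  have m: "(\<lambda>\<omega>. \<lambda>p\<in>?I. R \<omega> $ fst p $ snd p) \<in> M \<rightarrow>\<^sub>M PiM ?I (\<lambda>_. borel)"
    by (intro measurable_restrict) simp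
  have mb: "?b \<in> borel_measurable (PiM ?I (\<lambda>_. borel))"
  proof (intro borel_measurable_vecI)
    fix i j
    show "(\<lambda>x. ?b x $ i $ j) \<in> borel_measurable (PiM ?I (\<lambda>_. borel))"
      by (cases "i \<le> j") simp_all
  qed
  have "AE \<omega> in M. \<forall>i j. j < i \<longrightarrow> R \<omega> $ i $ j = 0"
    using low by (intro eventually_all_finite) auto
  then have "distr M borel R = distr M borel (\<lambda>\<omega>. ?b (\<lambda>p\<in>?I. R \<omega> $ fst p $ snd p))"
    by (intro distr_cong_AE refl measurable_compose[OF m mb] Rm)
      (auto simp: vec_eq_iff elim!: eventually_mono)
  also have "\<dots> = distr (PiM ?I ?N) borel ?b"
    unfolding eq distr_distr[OF mb m] by (simp add: comp_def)
  finally show ?thesis by (simp add: chi_normal_law_def)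
qed

subsection \<open>The least norm of a factor\<close>

text \<open>Both squared Frobenius norms are the trace of the same Gram matrix.\<close>

lemma norm_psd_sqrt_gram:
  fixes A :: "real^'k^'n"
  assumes "CARD('k) \<le> CARD('n)"
  shows "norm (psd_sqrt (transpose A ** A)) = norm A"
proof -
  let ?P = "psd_sqrt (transpose A ** A)"
  note P = psd_sqrt_gram[OF assms, of A]
  have "?P \<bullet> ?P = mat 1 \<bullet> (transpose ?P ** ?P)"
    using inner_matrix_mult_left[of ?P "mat 1" ?P] by simp
  also have "\<dots> = mat 1 \<bullet> (transpose A ** A)" using P by (simp add: pos_semidef_def)
  also have "\<dots> = A \<bullet> A" using inner_matrix_mult_left[of A "mat 1" A] by simp
  finally show ?thesis by (simp add: norm_eq_sqrt_inner)
qed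

lemma closed_pos_semidef: "closed {P :: real^'k^'k. pos_semidef P}"
proof -
  have "closed {P :: real^'k^'k. transpose P = P}"
    by (intro closed_Collect_eq) (auto simp: transpose_def intro!: continuous_intros)
  moreover have "closed {P :: real^'k^'k. \<forall>x. 0 \<le> x \<bullet> (P *v x)}"
    by (intro closed_Collect_all closed_Collect_le)
      (auto simp: matrix_vector_mult_def intro!: continuous_intros)
  ultimately have "closed ({P. transpose P = P} \<inter> {P :: real^'k^'k. \<forall>x. 0 \<le> x \<bullet> (P *v x)})"
    by (rule closed_Int)
  then show ?thesis by (simp add: pos_semidef_def Collect_conj_eq)
qed

text \<open>By uniqueness of the root, closed conditions describe the graph; norm preservation keeps
  the values over a ball in a compact ball, where a closed graph implies continuity.\<close>

lemma continuous_psd_sqrt_gram: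
  assumes kn: "CARD('k) \<le> CARD('n)"
  shows "continuous_on UNIV (\<lambda>A :: real^'k^'n. psd_sqrt (transpose A ** A))"
proof -
  let ?f = "\<lambda>A :: real^'k^'n. psd_sqrt (transpose A ** A)"
  have on_ball: "continuous_on (cball 0 r) ?f" for r
  proof (rule continuous_from_closed_graph)
    show "compact (cball (0 :: real^'k^'k) r)" by simp
    show "?f \<in> cball 0 r \<rightarrow> cball 0 r" by (simp add: norm_psd_sqrt_gram[OF kn])
    have "(\<lambda>A. (A, ?f A)) ` cball 0 r = {z. fst z \<in> cball 0 r} \<inter> {z. pos_semidef (snd z)}
        \<inter> {z. snd z ** snd z = transpose (fst z) ** fst z}"
      using psd_sqrt_gram[OF kn] by (auto simp: image_iff intro: psd_sqrt_eq[symmetric])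
    moreover have "closed {z :: (real^'k^'n) \<times> (real^'k^'k). fst z \<in> cball 0 r}"
      unfolding mem_cball_0 by (intro closed_Collect_le) (auto intro!: continuous_intros)
    moreover have "closed {z :: (real^'k^'n) \<times> (real^'k^'k). pos_semidef (snd z)}"
      using closed_vimage[OF closed_pos_semidef continuous_on_snd[OF continuous_on_id]] by (simp add: vimage_def)
    moreover have "closed {z :: (real^'k^'n) \<times> (real^'k^'k). snd z ** snd z = transpose (fst z) ** fst z}"
      by (intro closed_Collect_eq)
        (auto simp: transpose_def matrix_matrix_mult_def intro!: continuous_intros)
    ultimately show "closed ((\<lambda>A. (A, ?f A)) ` cball 0 r)" by (simp only: closed_Int)
  qed
  have "isCont ?f A" for A
  proof -
    have "A \<in> interior (cball 0 (norm A + 1))" by simp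
    then show ?thesis using continuous_on_interior[OF on_ball] by blast
  qed
  then show ?thesis by (simp add: continuous_on_eq_continuous_at)
qed

text \<open>By the polar decomposition, \<open>V (A\<^sup>*A)\<^sup>1\<^sup>/\<^sup>2\<close> with \<open>V\<close> orthogonal runs through all
  \<open>k \<times> k\<close> matrices with the same Gram matrix as \<open>A\<close>.\<close>

definition gram_norm :: "(real^'k \<Rightarrow> real) \<Rightarrow> real^'k^'n \<Rightarrow> real" where
  "gram_norm Y A = (INF V\<in>{V. orthogonal_matrix V}. op_norm Y Y (V ** psd_sqrt (transpose A ** A)))"

context
  fixes Y :: "real^'k \<Rightarrow> real"
  assumes Y: "is_norm Y" and kn: "CARD('k) \<le> CARD('n::finite)"
begin

lemma gram_norm_bdd: "bdd_below ((\<lambda>V. op_norm Y Y (V ** B)) ` {V. orthogonal_matrix V})"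
  by (rule bdd_belowI[of _ 0]) (auto simp: op_norm_nonneg[OF Y Y])

lemma orthogonal_nonempty: "{V :: real^'k^'k. orthogonal_matrix V} \<noteq> {}"
  using orthogonal_matrix_id by blast

lemma gram_norm_nonneg: "0 \<le> gram_norm Y (A :: real^'k^'n)"
  unfolding gram_norm_def
  by (rule cINF_greatest[OF orthogonal_nonempty]) (rule op_norm_nonneg[OF Y Y])

lemma gram_norm_le:
  fixes A :: "real^'k^'n"
  assumes eq: "transpose T ** T = transpose A ** A"
  shows "gram_norm Y A \<le> op_norm Y Y T"
proof -
  let ?P = "psd_sqrt (transpose A ** A)"
  note P = psd_sqrt_gram[OF kn, of A]
  have "transpose ?P ** ?P = transpose T ** T" using P eq by (simp add: pos_semidef_def)
  then obtain V where V: "V \<in> stiefel" "T = V ** ?P" using stiefel_factor[OF order_refl] by blast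
  show ?thesis unfolding gram_norm_def
    by (rule cINF_lower2[OF gram_norm_bdd, of V])
      (use V(1) V(2)[symmetric] in \<open>simp_all add: stiefel_def orthogonal_matrix\<close>)
qed

lemma gram_norm_greatest:
  fixes A :: "real^'k^'n"
  assumes "\<And>T. transpose T ** T = transpose A ** A \<Longrightarrow> c \<le> op_norm Y Y T"
  shows "c \<le> gram_norm Y A"
  unfolding gram_norm_def
proof (rule cINF_greatest[OF orthogonal_nonempty])
  let ?P = "psd_sqrt (transpose A ** A)"
  fix V :: "real^'k^'k" assume "V \<in> {V. orthogonal_matrix V}"
  then have "V \<in> stiefel" by (simp add: stiefel_def orthogonal_matrix)
  from stiefel_mult_gram[OF this, of ?P] psd_sqrt_gram[OF kn, of A]
  show "c \<le> op_norm Y Y (V ** ?P)" by (intro assms) (simp add: pos_semidef_def)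
qed

lemma gram_norm_orthogonal:
  fixes A :: "real^'k^'n"
  assumes "orthogonal_matrix U"
  shows "gram_norm Y (U ** A) = gram_norm Y A"
proof -
  have "U \<in> stiefel" using assms by (simp add: stiefel_def orthogonal_matrix)
  then show ?thesis by (simp add: gram_norm_def stiefel_mult_gram)
qed

text \<open>The infimum is over an uncountable family, but one of continuous functions, so its
  strict sublevel sets are unions of open sets.\<close>

lemma measurable_gram_norm [measurable]: "(gram_norm Y :: real^'k^'n \<Rightarrow> real) \<in> borel_measurable borel"
  unfolding borel_measurable_iff_less
proof
  fix a
  let ?f = "\<lambda>V (A :: real^'k^'n). op_norm Y Y (V ** psd_sqrt (transpose A ** A))"
  have "{A \<in> space borel. gram_norm Y A < a} = (\<Union>V\<in>{V. orthogonal_matrix V}. {A. ?f V A < a})"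
    unfolding gram_norm_def by (auto simp: cINF_less_iff[OF orthogonal_nonempty gram_norm_bdd])
  moreover have "open {A. ?f V A < a}" for V
  proof (intro open_Collect_less continuous_on_const)
    have "continuous_on UNIV (\<lambda>P :: real^'k^'k. V ** P)"
      by (auto simp: matrix_matrix_mult_def intro!: continuous_intros)
    then have "continuous_on UNIV (\<lambda>A :: real^'k^'n. V ** psd_sqrt (transpose A ** A))"
      using continuous_on_compose2[OF _ continuous_psd_sqrt_gram[OF kn]] by auto
    then show "continuous_on UNIV (?f V)"
      using continuous_on_compose2[OF op_norm_continuous[OF Y Y]] by auto
  qed
  then have "open (\<Union>V\<in>{V. orthogonal_matrix V}. {A. ?f V A < a})" by (intro open_UN) blast
  ultimately show "{A \<in> space borel. gram_norm Y (A :: real^'k^'n) < a} \<in> sets borel" by simp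
qed

end

section \<open>Integrability and the comparison of expectations\<close>

lemma gaussian_matrix_integrable_norm:
  fixes \<Gamma> :: "'w \<Rightarrow> real^'k^'n"
  assumes M: "prob_space M" and g: "gaussian_matrix M 1 \<Gamma>"
  shows "integrable M (\<lambda>\<omega>. norm (\<Gamma> \<omega>))"
proof (rule Bochner_Integration.integrable_bound)
  show "integrable M (\<lambda>\<omega>. \<Sum>i\<in>UNIV. \<Sum>j\<in>UNIV. \<bar>\<Gamma> \<omega> $ i $ j\<bar>)"
    by (intro Bochner_Integration.integrable_sum gaussian_matrix_entry_integrable[OF M g])
  show "(\<lambda>\<omega>. norm (\<Gamma> \<omega>)) \<in> borel_measurable M"
    using gaussian_matrix_measurable[OF M g] by simp
  have "norm A \<le> (\<Sum>i\<in>UNIV. \<Sum>j\<in>UNIV. \<bar>A $ i $ j\<bar>)" for A :: "real^'k^'n"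
  proof -
    have "norm A \<le> (\<Sum>i\<in>UNIV. norm (A $ i))"
      unfolding norm_vec_def[of A] by (rule L2_set_le_sum) simp
    also have "\<dots> \<le> (\<Sum>i\<in>UNIV. \<Sum>j\<in>UNIV. \<bar>A $ i $ j\<bar>)"
      by (intro sum_mono norm_le_l1_cart)
    finally show ?thesis .
  qed
  then show "AE \<omega> in M. norm (norm (\<Gamma> \<omega>)) \<le> norm (\<Sum>i\<in>UNIV. \<Sum>j\<in>UNIV. \<bar>\<Gamma> \<omega> $ i $ j\<bar>)"
    by (simp add: sum_nonneg)
qed

lemma integrable_gauss_mat_dominated:
  fixes f :: "real^'k^'n \<Rightarrow> real"
  assumes int: "integrable gauss_mat (norm :: real^'k^'n \<Rightarrow> real)"
    and [measurable]: "f \<in> borel_measurable borel" and le: "\<And>A. \<bar>f A\<bar> \<le> b + a * norm A"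
  shows "integrable gauss_mat f"
proof -
  interpret prob_space "gauss_mat :: (real^'k^'n) measure" by (rule prob_space_gauss_mat)
  show ?thesis
  proof (rule Bochner_Integration.integrable_bound)
    show "integrable gauss_mat (\<lambda>A :: real^'k^'n. b + a * norm A)" using int by simp
    show "AE A in gauss_mat. norm (f A) \<le> norm (b + a * norm A)"
    proof (rule AE_I2)
      fix A show "norm (f A) \<le> norm (b + a * norm A)" using le[of A] by simp
    qed
  qed simp
qed

lemma gaussian_le_gram_norm:
  fixes \<mu> :: "(real^'k^'n) measure"
  assumes kn: "CARD('k) \<le> CARD('n)" and Y: "is_norm Y" and Z: "is_norm Z"
    and \<mu>: "haar_stiefel \<mu>" and int: "integrable gauss_mat (norm :: real^'k^'n \<Rightarrow> real)"
  shows "(\<integral>A. op_norm Y Z A \<partial>(gauss_mat :: (real^'k^'n) measure))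
    \<le> (\<integral>Q. op_norm Y Z Q \<partial>\<mu>) * (\<integral>A. gram_norm Y A \<partial>(gauss_mat :: (real^'k^'n) measure))"
proof -
  let ?\<gamma> = "gauss_mat :: (real^'k^'n) measure" and ?h = "op_norm Y Z :: real^'k^'n \<Rightarrow> real"
  have \<mu>p: "prob_space \<mu>" and \<mu>s: "sets \<mu> = sets borel" and \<mu>a: "AE Q in \<mu>. Q \<in> stiefel"
    using \<mu> by (auto simp: haar_stiefel_def)
  interpret \<mu>: prob_space \<mu> by (rule \<mu>p)
  interpret \<gamma>: prob_space ?\<gamma> by (rule prob_space_gauss_mat)
  have \<mu>inv: "distr \<mu> borel ((**) U) = \<mu>" if "orthogonal_matrix U" for U :: "real^'n^'n"
  proof -
    have "distr \<mu> borel (\<lambda>Q. U ** Q ** mat 1) = \<mu>"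
      using \<mu> that orthogonal_matrix_id unfolding haar_stiefel_def by blast
    then show ?thesis by (simp only: matrix_mul_rid)
  qed
  have Um: "(**) U \<in> borel_measurable (borel :: (real^'k^'n) measure)" for U :: "real^'n^'n"
    by (intro borel_measurable_continuous_onI) (auto simp: matrix_matrix_mult_def intro!: continuous_intros)
  obtain L where L: "L > 0" "\<And>A B. \<bar>?h A - ?h B\<bar> \<le> L * norm (A - B)"
    using op_norm_lipschitz[OF Y Z] by blast
  define c where "c = (\<integral>Q. ?h Q \<partial>\<mu>)"
  \<comment> \<open>These properties all survive averaging of orthogonal left translates. The last
    one extends a bound on the Stiefel manifold to all matrices.\<close>
  define F where "F = {f. (\<forall>A B. \<bar>f A - f B\<bar> \<le> L * norm (A - B)) \<and> (\<integral>Q. f Q \<partial>\<mu>) = c \<and>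
      (\<integral>A. f A \<partial>?\<gamma>) = (\<integral>A. ?h A \<partial>?\<gamma>) \<and> (\<forall>A T. f (A ** T) \<le> f A * op_norm Y Y T)}"
  have lip: "\<bar>f A - f B\<bar> \<le> L * norm (A - B)" if "f \<in> F" for f A B
    using that by (simp add: F_def)
  have F_int: "(\<integral>Q. f Q \<partial>\<mu>) = c" if "f \<in> F" for f
    using that by (simp add: F_def)
  have F_meas: "f \<in> borel_measurable borel" if "f \<in> F" for f
  proof (intro borel_measurable_continuous_onI)
    have "L-lipschitz_on UNIV f" using lip[OF that] L by (intro lipschitz_onI) (auto simp: dist_norm)
    then show "continuous_on UNIV f" by (rule lipschitz_on_continuous_on)
  qed
  have F_bound: "\<bar>f A\<bar> \<le> \<bar>f 0\<bar> + L * norm A" if "f \<in> F" for f A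
    using lip[OF that, of A 0] by simp
  have F_\<gamma>: "integrable ?\<gamma> f" if "f \<in> F" for f
    by (rule integrable_gauss_mat_dominated[OF int F_meas[OF that] F_bound[OF that]])
  have F_\<mu>: "integrable \<mu> f" if f: "f \<in> F" for f
  proof (rule \<mu>.integrable_const_bound)
    show "AE Q in \<mu>. norm (f Q) \<le> \<bar>f 0\<bar> + L * sqrt CARD('k)"
      using \<mu>a
    proof eventually_elim
      case (elim Q)
      then show ?case using F_bound[OF f, of Q] by (simp add: norm_stiefel)
    qed
    show "f \<in> borel_measurable \<mu>" by (simp add: measurable_cong_sets[OF \<mu>s refl] F_meas[OF f])
  qed
  have hF: "?h \<in> F" using L(2) op_norm_mult[OF Y Z] by (simp add: F_def c_def)
  have avg: "(\<lambda>A. (\<Sum>i\<in>I. f (U i ** A)) / real (card I)) \<in> F"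
    if f: "f \<in> F" and I: "finite I" "I \<noteq> {}" and U: "\<And>i. orthogonal_matrix (U i)"
    for f and I :: "(real^'k^'n) set" and U :: "real^'k^'n \<Rightarrow> real^'n^'n"
  proof -
    have N: "real (card I) > 0" using I by (simp add: card_gt_0_iff)
    have lip': "\<bar>(\<Sum>i\<in>I. f (U i ** A)) / real (card I) - (\<Sum>i\<in>I. f (U i ** B)) / real (card I)\<bar> \<le> L * norm (A - B)" for A B
    proof -
      have "\<bar>(\<Sum>i\<in>I. f (U i ** A)) - (\<Sum>i\<in>I. f (U i ** B))\<bar> \<le> (\<Sum>i\<in>I. \<bar>f (U i ** A) - f (U i ** B)\<bar>)"
        unfolding sum_subtractf[symmetric] by (rule sum_abs)
      also have "\<dots> \<le> (\<Sum>i\<in>I. L * norm (A - B))"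
      proof (rule sum_mono)
        fix i
        show "\<bar>f (U i ** A) - f (U i ** B)\<bar> \<le> L * norm (A - B)"
          using lip[OF f, of "U i ** A" "U i ** B"]
          by (simp add: matrix_diff_ldistrib[symmetric] norm_orthogonal_mult[OF U])
      qed
      finally have "\<bar>(\<Sum>i\<in>I. f (U i ** A)) - (\<Sum>i\<in>I. f (U i ** B))\<bar> \<le> real (card I) * (L * norm (A - B))"
        by simp
      then show ?thesis using N
        by (simp add: diff_divide_distrib[symmetric] abs_divide pos_divide_le_eq mult.commute)
    qed
    \<comment> \<open>Stated for a generic invariant \<open>M\<close>, to be used for both
      \<open>\<mu>\<close> and the Gaussian law.\<close>
    have int': "(\<integral>Q. (\<Sum>i\<in>I. f (U i ** Q)) / real (card I) \<partial>M) = (\<integral>Q. f Q \<partial>M)"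
      if M: "sets M = sets borel" "\<And>i. distr M borel ((**) (U i)) = M" "integrable M f" for M
    proof -
      have m: "(**) (U i) \<in> borel_measurable M" for i
        by (simp add: measurable_cong_sets[OF M(1) refl] Um)
      have "integrable M (\<lambda>Q. f (U i ** Q))" for i
        by (rule integrable_distr[OF m]) (simp add: M)
      moreover have "(\<integral>Q. f (U i ** Q) \<partial>M) = (\<integral>Q. f Q \<partial>M)" for i
        using integral_distr[OF m F_meas[OF f], of i] by (simp add: M)
      ultimately show ?thesis using N by (simp add: Bochner_Integration.integral_sum)
    qed
    have mult': "(\<Sum>i\<in>I. f (U i ** (A ** T))) / real (card I) \<le> (\<Sum>i\<in>I. f (U i ** A)) / real (card I) * op_norm Y Y T" for A T
    proof -
      have "(\<Sum>i\<in>I. f (U i ** (A ** T))) \<le> (\<Sum>i\<in>I. f (U i ** A) * op_norm Y Y T)"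
        using f by (intro sum_mono) (simp add: F_def matrix_mul_assoc)
      also have "\<dots> = (\<Sum>i\<in>I. f (U i ** A)) * op_norm Y Y T" by (simp add: sum_distrib_right)
      finally show ?thesis using N by (simp add: divide_right_mono)
    qed
    have "(\<integral>A. f A \<partial>?\<gamma>) = (\<integral>A. ?h A \<partial>?\<gamma>)" using f by (simp add: F_def)
    then show ?thesis
      unfolding F_def
      using lip' mult' int'[OF \<mu>s \<mu>inv[OF U] F_\<mu>[OF f]] F_int[OF f]
        int'[OF sets_gauss_mat distr_gauss_mat_orthogonal[OF U] F_\<gamma>[OF f]]
      by (intro CollectI conjI allI) (simp_all only:)
  qed
  obtain C where C: "C > 0" "\<And>A :: real^'k^'k. op_norm Y Y A \<le> C * norm A"
    using op_norm_le_norm[OF Y Y] by blast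
  have gi: "integrable ?\<gamma> (gram_norm Y)"
  proof (rule integrable_gauss_mat_dominated[OF int measurable_gram_norm[OF Y kn]])
    fix A :: "real^'k^'n"
    let ?P = "psd_sqrt (transpose A ** A)"
    have "gram_norm Y A \<le> op_norm Y Y ?P"
      using psd_sqrt_gram[OF kn, of A] by (intro gram_norm_le[OF Y kn]) (simp add: pos_semidef_def)
    also have "\<dots> \<le> C * norm A" using C(2)[of ?P] by (simp add: norm_psd_sqrt_gram[OF kn])
    finally show "\<bar>gram_norm Y A\<bar> \<le> 0 + C * norm A" using gram_norm_nonneg[OF Y kn, of A] by simp
  qed
  let ?G = "\<integral>A. gram_norm Y A \<partial>?\<gamma>"
  have G: "0 \<le> ?G" by (simp add: gram_norm_nonneg[OF Y kn])
  have main: "(\<integral>A. ?h A \<partial>?\<gamma>) \<le> (c + \<epsilon>) * ?G" if \<epsilon>: "\<epsilon> > 0" for \<epsilon>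
  proof -
    obtain f where f: "f \<in> F" "\<And>Q. Q \<in> stiefel \<Longrightarrow> f Q \<le> c + \<epsilon>"
      using exists_flat_average[OF \<mu>p \<mu>s \<mu>a hF L(1) avg lip F_int \<epsilon>] by blast
    have c0: "0 \<le> c" by (simp add: c_def op_norm_nonneg[OF Y Z])
    have "f A \<le> (c + \<epsilon>) * gram_norm Y A" for A
    proof -
      \<comment> \<open>Division by the positive number \<open>c + \<epsilon>\<close> gives a lower
        bound common to all factors \<open>T\<close>, as the infimum requires.\<close>
      have "f A / (c + \<epsilon>) \<le> gram_norm Y A"
      proof (rule gram_norm_greatest[OF Y kn])
        fix T :: "real^'k^'k" assume "transpose T ** T = transpose A ** A"
        then obtain Q where Q: "Q \<in> stiefel" "A = Q ** T" using stiefel_factor[OF kn] by blast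
        have "f A \<le> f Q * op_norm Y Y T" using f(1) by (simp add: F_def Q(2))
        also have "\<dots> \<le> (c + \<epsilon>) * op_norm Y Y T"
          by (intro mult_right_mono f(2) Q op_norm_nonneg[OF Y Y])
        finally show "f A / (c + \<epsilon>) \<le> op_norm Y Y T"
          using c0 \<epsilon> by (simp add: pos_divide_le_eq mult.commute)
      qed
      then show ?thesis using c0 \<epsilon> by (simp add: pos_divide_le_eq mult.commute)
    qed
    then have "(\<integral>A. f A \<partial>?\<gamma>) \<le> (\<integral>A. (c + \<epsilon>) * gram_norm Y A \<partial>?\<gamma>)"
      by (intro integral_mono F_\<gamma>[OF f(1)] integrable_mult_right gi)
    then show ?thesis using f(1) by (simp add: F_def)
  qed
  have "(\<integral>A. ?h A \<partial>?\<gamma>) \<le> c * ?G"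
  proof (rule field_le_epsilon)
    fix e :: real assume e: "e > 0"
    \<comment> \<open>The 1 is added because \<open>?G\<close> is only known to be
      nonnegative.\<close>
    define \<epsilon> where "\<epsilon> = e / (?G + 1)"
    have "\<epsilon> * ?G \<le> e" using e G by (simp add: \<epsilon>_def field_simps)
    moreover have "\<epsilon> > 0" using e G by (simp add: \<epsilon>_def)
    ultimately show "(\<integral>A. ?h A \<partial>?\<gamma>) \<le> c * ?G + e" using main[of \<epsilon>] by (simp add: algebra_simps)
  qed
  then show ?thesis by (simp add: c_def)
qed

text \<open>The frame is an isometry and each triangular column keeps its length. This gives
  integrability of the operator norm of the factor.\<close>

lemma norm_triangular_factor:
  fixes \<rho> :: "'k::{finite,linorder} \<Rightarrow> 'n::finite"
  assumes \<rho>: "inj \<rho>"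
  shows "norm (triangular_factor \<rho> A) = norm A"
proof -
  have n: "(norm (of_columns c :: real^('k::{finite,linorder})^'n))\<^sup>2 = (\<Sum>j\<in>UNIV. (norm (c j))\<^sup>2)" for c :: "'k::{finite,linorder} \<Rightarrow> real^'n"
    unfolding power2_norm_eq_inner inner_vec_def[of "of_columns c"] inner_vec_def[of "_ :: real^'n"]
    by (subst sum.swap) (simp add: inner_vec_def)
  define c where "c j = (\<chi> r. A $ r $ j)" for j
  have A: "A = of_columns c" by (simp add: c_def vec_eq_iff)
  let ?T = "triangular_factor \<rho> A"
  have "?T \<bullet> ?T = (frame \<rho> ** ?T) \<bullet> (frame \<rho> ** ?T)"
    using frame_stiefel[OF \<rho>] by (simp add: inner_matrix_mult_left stiefel_def matrix_mul_assoc)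
  then have "(norm ?T)\<^sup>2 = (norm (frame \<rho> ** ?T))\<^sup>2" by (simp add: power2_norm_eq_inner)
  also have "\<dots> = (norm A)\<^sup>2"
    unfolding A frame_mult_triangular_factor[OF \<rho>] n norm_triangular_column[OF \<rho>] ..
  finally show ?thesis by simp
qed

theorem theorem11:
  fixes Y :: "real^('k::{finite,linorder}) \<Rightarrow> real" and Z :: "real^('n::finite) \<Rightarrow> real"
    and MG :: "'a measure" and G :: "'a \<Rightarrow> real^('k::{finite,linorder})^('n::finite)"
    and MQ :: "'b measure" and Q :: "'b \<Rightarrow> real^('k::{finite,linorder})^('n::finite)"
    and MT :: "'c measure" and T :: "'c \<Rightarrow> real^('k::{finite,linorder})^('k::{finite,linorder})"
  assumes "CARD('k) \<le> CARD('n)"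
    and "is_norm Y" and "is_norm Z"
    and "prob_space MG" and "prob_space MQ" and "prob_space MT"
    and "gaussian_matrix MG (1 / real CARD('n)) G"
    and "uniform_stiefel MQ Q"
    and "chi_normal_triangular MT CARD('n) T \<or> wishart_sqrt TYPE('n) MT T"
  shows "prob_space.expectation MG (\<lambda>\<omega>. op_norm Y Z (G \<omega>))
      \<le> (real CARD('n) powr (- 1 / 2) * prob_space.expectation MT (\<lambda>\<omega>. op_norm Y Y (T \<omega>)))
         * prob_space.expectation MQ (\<lambda>\<omega>. op_norm Y Z (Q \<omega>))"
proof -
  note kn = assms(1) and Y = assms(2) and Z = assms(3)
  interpret MG: prob_space MG by fact
  interpret MT: prob_space MT by fact
  let ?\<gamma> = "gauss_mat :: (real^('k::{finite,linorder})^'n) measure"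
  let ?s = "sqrt (real CARD('n))"
  have s: "?s > 0" by (simp add: card_gt_0_iff)
  \<comment> \<open>Rescaled to unit variance; the inverse factor becomes
    \<open>n powr (- 1 / 2)\<close> at the end.\<close>
  define \<Gamma> where "\<Gamma> \<omega> = ?s *\<^sub>R G \<omega>" for \<omega>
  have \<Gamma>: "gaussian_matrix MG 1 \<Gamma>"
    unfolding gaussian_matrix_def
  proof (intro conjI allI)
    have "MG.indep_vars (\<lambda>_. borel) (\<lambda>p \<omega>. G \<omega> $ fst p $ snd p) UNIV"
      using assms(7) by (simp add: gaussian_matrix_def case_prod_beta')
    then have "MG.indep_vars (\<lambda>_. borel) (\<lambda>p \<omega>. ?s * (G \<omega> $ fst p $ snd p)) UNIV"
      by (rule MG.indep_vars_compose2[where Y = "\<lambda>_ x. ?s * x"]) simp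
    then show "MG.indep_vars (\<lambda>_. borel) (\<lambda>(i, j) \<omega>. \<Gamma> \<omega> $ i $ j) UNIV"
      by (simp add: \<Gamma>_def case_prod_beta')
    fix i j
    have "distributed MG lborel (\<lambda>\<omega>. G \<omega> $ i $ j) (normal_density 0 (sqrt (1 / real CARD('n))))"
      using assms(7) by (simp add: gaussian_matrix_def)
    then have "distributed MG lborel (\<lambda>\<omega>. (G \<omega> $ i $ j - 0) / sqrt (1 / real CARD('n))) std_normal_density"
      by (subst (asm) MG.normal_standard_normal_convert) (simp_all add: card_gt_0_iff)
    then show "distributed MG lborel (\<lambda>\<omega>. \<Gamma> \<omega> $ i $ j) (normal_density 0 (sqrt 1))"
      by (simp add: \<Gamma>_def real_sqrt_divide mult.commute)
  qed
  have \<Gamma>m: "\<Gamma> \<in> borel_measurable MG" by (rule gaussian_matrix_measurable[OF MG.prob_space_axioms \<Gamma>])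
  have \<Gamma>l: "distr MG borel \<Gamma> = ?\<gamma>" by (rule gaussian_matrix_law[OF MG.prob_space_axioms \<Gamma>])
  have int: "integrable ?\<gamma> norm"
    unfolding \<Gamma>l[symmetric]
    using gaussian_matrix_integrable_norm[OF MG.prob_space_axioms \<Gamma>] \<Gamma>m by (simp add: integrable_distr_eq)
  have hm: "op_norm Y Z \<in> borel_measurable (borel :: (real^('k::{finite,linorder})^'n) measure)"
    by (intro borel_measurable_continuous_onI op_norm_continuous Y Z)
  have tm: "op_norm Y Y \<in> borel_measurable (borel :: (real^('k::{finite,linorder})^('k::{finite,linorder})) measure)"
    by (intro borel_measurable_continuous_onI op_norm_continuous Y)
  have Qm: "Q \<in> borel_measurable MQ" and haar: "haar_stiefel (distr MQ borel Q)"
    using assms(8) by (auto simp: uniform_stiefel_def)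
  obtain C where C: "C > 0" "\<And>A :: real^('k::{finite,linorder})^('k::{finite,linorder}). op_norm Y Y A \<le> C * norm A"
    using op_norm_le_norm[OF Y Y] by blast
  have Pm: "(\<lambda>A :: real^('k::{finite,linorder})^'n. psd_sqrt (transpose A ** A)) \<in> borel_measurable borel"
    by (intro borel_measurable_continuous_onI continuous_psd_sqrt_gram kn)
  have T: "(\<integral>A. gram_norm Y A \<partial>?\<gamma>) \<le> (\<integral>\<omega>. op_norm Y Y (T \<omega>) \<partial>MT)"
    using assms(9)
  proof
    assume T: "wishart_sqrt TYPE('n) MT T"
    then obtain \<gamma>' :: "(real^('k::{finite,linorder})^'n) measure" where \<gamma>': "prob_space \<gamma>'" "sets \<gamma>' = sets borel"
      "gaussian_matrix \<gamma>' 1 (\<lambda>\<Gamma>. \<Gamma>)" "distr MT borel T = distr \<gamma>' borel (\<lambda>\<Gamma>. psd_sqrt (transpose \<Gamma> ** \<Gamma>))"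
      and Tm: "T \<in> borel_measurable MT"
      by (auto simp: wishart_sqrt_def)
    \<comment> \<open>Independent standard normal entries force the law supplied with
      \<open>T\<close> to be \<open>gauss_mat\<close>.\<close>
    have "\<gamma>' = distr \<gamma>' borel (\<lambda>A. A)" using \<gamma>'(2) by (simp add: distr_id2)
    then have "\<gamma>' = ?\<gamma>" using gaussian_matrix_law[OF \<gamma>'(1,3)] by simp
    then have law: "distr MT borel T = distr ?\<gamma> borel (\<lambda>A. psd_sqrt (transpose A ** A))"
      using \<gamma>'(4) by simp
    have "(\<integral>A. gram_norm Y A \<partial>?\<gamma>) \<le> (\<integral>A. op_norm Y Y (psd_sqrt (transpose A ** A)) \<partial>?\<gamma>)"
    proof (rule integral_mono')
      show "integrable ?\<gamma> (\<lambda>A. op_norm Y Y (psd_sqrt (transpose A ** A)))"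
      proof (rule integrable_gauss_mat_dominated[OF int measurable_compose[OF Pm tm]])
        fix A :: "real^('k::{finite,linorder})^'n"
        show "\<bar>op_norm Y Y (psd_sqrt (transpose A ** A))\<bar> \<le> 0 + C * norm A"
          using C(2)[of "psd_sqrt (transpose A ** A)"]
          by (simp add: norm_psd_sqrt_gram[OF kn] op_norm_nonneg[OF Y Y])
      qed
      fix A :: "real^('k::{finite,linorder})^'n"
      show "gram_norm Y A \<le> op_norm Y Y (psd_sqrt (transpose A ** A))"
        using psd_sqrt_gram[OF kn, of A] by (intro gram_norm_le[OF Y kn]) (simp add: pos_semidef_def)
    qed (rule op_norm_nonneg[OF Y Y])
    also have "\<dots> = (\<integral>B. op_norm Y Y B \<partial>distr MT borel T)"
      unfolding law using Pm tm by (simp add: integral_distr)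
    also have "\<dots> = (\<integral>\<omega>. op_norm Y Y (T \<omega>) \<partial>MT)" using Tm tm by (simp add: integral_distr)
    finally show ?thesis .
  next
    assume T: "chi_normal_triangular MT CARD('n) T"
    then have Tm: "T \<in> borel_measurable MT" by (simp add: chi_normal_triangular_def)
    obtain \<rho> :: "'k::{finite,linorder} \<Rightarrow> 'n" where \<rho>: "inj \<rho>" using exists_inj[OF kn] by blast
    have "distr MT borel T = distr MG borel (\<lambda>\<omega>. triangular_factor \<rho> (\<Gamma> \<omega>))"
      using chi_normal_triangular_law[OF MT.prob_space_axioms T]
        chi_normal_triangular_law[OF MG.prob_space_axioms
          chi_normal_triangular_factor[OF MG.prob_space_axioms \<Gamma> \<rho>]] by simp
    also have "\<dots> = distr ?\<gamma> borel (triangular_factor \<rho>)"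
      unfolding \<Gamma>l[symmetric] using \<Gamma>m by (simp add: distr_distr comp_def)
    finally have law: "distr MT borel T = distr ?\<gamma> borel (triangular_factor \<rho>)" .
    have int': "integrable ?\<gamma> (\<lambda>A. op_norm Y Y (triangular_factor \<rho> A))"
    proof (rule integrable_gauss_mat_dominated[OF int measurable_compose[OF measurable_triangular_factor tm]])
      fix A :: "real^('k::{finite,linorder})^'n"
      show "\<bar>op_norm Y Y (triangular_factor \<rho> A)\<bar> \<le> 0 + C * norm A"
        using C(2)[of "triangular_factor \<rho> A"]
        by (simp add: norm_triangular_factor[OF \<rho>] op_norm_nonneg[OF Y Y])
    qed
    note gm = measurable_gram_norm[OF Y kn]
    have "(\<integral>\<^sup>+A. ennreal (gram_norm Y A) \<partial>?\<gamma>)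
        = (\<integral>\<^sup>+A. ennreal (gram_norm Y (frame \<rho> ** triangular_factor \<rho> A)) \<partial>?\<gamma>)"
      by (rule nn_integral_triangular_factor[OF \<rho> measurable_compose[OF gm measurable_ennreal], symmetric])
        (simp add: gram_norm_orthogonal[OF Y kn])
    \<comment> \<open>The frame lies in the Stiefel manifold, so the factor has the Gram matrix of
      the framed matrix and competes in the infimum.\<close>
    also have "\<dots> \<le> (\<integral>\<^sup>+A. ennreal (op_norm Y Y (triangular_factor \<rho> A)) \<partial>?\<gamma>)"
      by (intro nn_integral_mono ennreal_leI gram_norm_le[OF Y kn] stiefel_mult_gram[symmetric] frame_stiefel \<rho>)
    also have "\<dots> = ennreal (\<integral>A. op_norm Y Y (triangular_factor \<rho> A) \<partial>?\<gamma>)"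
      by (rule nn_integral_eq_integral[OF int']) (simp add: op_norm_nonneg[OF Y Y])
    finally have "(\<integral>A. gram_norm Y A \<partial>?\<gamma>) \<le> (\<integral>A. op_norm Y Y (triangular_factor \<rho> A) \<partial>?\<gamma>)"
      using gm by (intro integral_real_bounded[OF Bochner_Integration.integral_nonneg]) (simp_all add: op_norm_nonneg[OF Y Y])
    also have "\<dots> = (\<integral>B. op_norm Y Y B \<partial>distr MT borel T)"
      unfolding law using tm by (simp add: integral_distr)
    also have "\<dots> = (\<integral>\<omega>. op_norm Y Y (T \<omega>) \<partial>MT)" using Tm tm by (simp add: integral_distr)
    finally show ?thesis .
  qed
  have GG: "G \<omega> = (1 / ?s) *\<^sub>R \<Gamma> \<omega>" for \<omega> using s by (simp add: \<Gamma>_def)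
  have "(\<integral>\<omega>. op_norm Y Z (G \<omega>) \<partial>MG) = 1 / ?s * (\<integral>\<omega>. op_norm Y Z (\<Gamma> \<omega>) \<partial>MG)"
    unfolding GG op_norm_scaleR[OF Y Z] using s by simp
  also have "(\<integral>\<omega>. op_norm Y Z (\<Gamma> \<omega>) \<partial>MG) = (\<integral>A. op_norm Y Z A \<partial>?\<gamma>)"
    unfolding \<Gamma>l[symmetric] using \<Gamma>m hm by (simp add: integral_distr)
  also have "1 / ?s * \<dots> \<le> 1 / ?s * ((\<integral>A. op_norm Y Z A \<partial>distr MQ borel Q) * (\<integral>A. gram_norm Y A \<partial>?\<gamma>))"
    using s by (intro mult_left_mono gaussian_le_gram_norm[OF kn Y Z haar int]) simp
  also have "\<dots> \<le> 1 / ?s * ((\<integral>A. op_norm Y Z A \<partial>distr MQ borel Q) * (\<integral>\<omega>. op_norm Y Y (T \<omega>) \<partial>MT))"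
    using s T by (intro mult_left_mono) (simp_all add: op_norm_nonneg[OF Y Z])
  also have "(\<integral>A. op_norm Y Z A \<partial>distr MQ borel Q) = (\<integral>\<omega>. op_norm Y Z (Q \<omega>) \<partial>MQ)"
    using Qm hm by (simp add: integral_distr)
  also have "1 / ?s = real CARD('n) powr (- 1 / 2)"
    by (simp add: powr_minus powr_half_sqrt field_simps)
  finally show ?thesis by (simp only: mult_ac)
qed

end
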